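(* Let $p\ge1$, $\gamma>0$, and let $(\kappa_i)_{i\ge1}$ be positive with $\kappa_i\asymp\exp(-\gamma i^p)$. Let $\alpha\ge0$, $\xi>0$, $\lambda_i=i^{-\alpha}\exp(-\xi i^p)$, and let the prior be the truncated Gaussian product prior $\Pi=\bigotimes_{i=1}^{k_n}N(0,\lambda_i)$, where $k_n$ is the solution $x$ of $1=n\,x^{-\alpha}\exp(-(\xi+2\gamma)x^p)$. Suppose the true $f_0$ belongs to $S^\beta$ for some $\beta>0$. Then for every $R>0$ and every sequence $M_n\to\infty$, $$\sup_{\|f_0\|_\beta\le R}\mathrm E_0\,\Pi\Bigl(f:\|f-f_0\|\ge M_n(\log n)^{-\beta/p}\Bigm|Y^n\Bigr)\to0\qquad(n\to\infty).$$
   Context: White noise sequence model: for $f\in\ell_2$ one observes $Y^n=(Y_1,Y_2,\dots)$ with $Y_i=\kappa_i f_i+n^{-1/2}Z_i$, where $Z_1,Z_2,\dots$ are independent standard normal and $(\kappa_i)$ is known. $\|\cdot\|$ is the $\ell_2$ norm. $S^\beta=\{f\in\ell_2:\|f\|_\beta^2:=\sum_i f_i^2i^{2\beta}<\infty\}$. Under the truncated prior the coordinates $f_i$, $i\le k_n$ ($i$ integer), are independent $N(0,\lambda_i)$ (variance $\lambda_i$) and $f_i=0$ for $i>k_n$. One has $k_n=\bigl(\frac{\log n}{\xi+2\gamma}+O(\log\log n)\bigr)^{1/p}$. $a_i\asymp b_i$ means $|a_i/b_i|$ is bounded away from $0$ and $\infty$. $\Pi(\cdot\mid Y^n)$ is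 the posterior distribution of $f$ given $Y^n$, and $\mathrm E_0$ is expectation when $Y^n$ is generated with $f=f_0$. *)

theory Defs
  imports "HOL-Probability.Probability"
begin

text \<open>
  Sequences \<open>(f\<^sub>i)\<close> with \<open>i \<ge> 1\<close> are functions on \<open>nat\<close> that are extensional
  on \<open>{1..}\<close>; series over \<open>i \<ge> 1\<close> are written with the index shifted by \<open>Suc\<close>.
\<close>

abbreviation seq_space :: "(nat \<Rightarrow> real) measure" where
  "seq_space \<equiv> \<Pi>\<^sub>M i\<in>{1..}. borel"

definition ell2 :: "(nat \<Rightarrow> real) set" where
  "ell2 = {f \<in> extensional {1..}. summable (\<lambda>i. (f (Suc i))\<^sup>2)}"

definition ell2_norm :: "(nat \<Rightarrow> real) \<Rightarrow> real" where
  "ell2_norm f = sqrt (\<Sum>i. (f (Suc i))\<^sup>2)"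

definition sobolev :: "real \<Rightarrow> (nat \<Rightarrow> real) set" where
  "sobolev \<beta> = {f \<in> ell2. summable (\<lambda>i. (f (Suc i))\<^sup>2 * real (Suc i) powr (2 * \<beta>))}"

definition sobolev_norm :: "real \<Rightarrow> (nat \<Rightarrow> real) \<Rightarrow> real" where
  "sobolev_norm \<beta> f = sqrt (\<Sum>i. (f (Suc i))\<^sup>2 * real (Suc i) powr (2 * \<beta>))"

definition comparable :: "(nat \<Rightarrow> real) \<Rightarrow> (nat \<Rightarrow> real) \<Rightarrow> bool" where
  "comparable a b \<longleftrightarrow> (\<exists>c>0. \<exists>C. \<forall>i\<ge>1. c \<le> \<bar>a i / b i\<bar> \<and> \<bar>a i / b i\<bar> \<le> C)"

text \<open>The law of \<open>Y\<^sup>n\<close>, where \<open>Y\<^sub>i = \<kappa>\<^sub>i f\<^sub>i + n\<^sup>-\<^sup>1\<^sup>/\<^sup>2 Z\<^sub>i\<close> with \<open>Z\<^sub>i\<close> i.i.d. standard normal.\<close>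

definition obs_law :: "(nat \<Rightarrow> real) \<Rightarrow> nat \<Rightarrow> (nat \<Rightarrow> real) \<Rightarrow> (nat \<Rightarrow> real) measure" where
  "obs_law \<kappa> n f =
     distr (\<Pi>\<^sub>M i\<in>{1..}. density lborel std_normal_density) seq_space
       (\<lambda>Z. \<lambda>i\<in>{1..}. \<kappa> i * f i + Z i / sqrt (real n))"

text \<open>
  The prior is a measure on \<open>ell2\<close>, with the trace of the product \<open>\<sigma>\<close>-algebra
  (which is the Borel \<open>\<sigma>\<close>-algebra of the norm); the product measure is concentrated on
  \<open>ell2\<close>. The parameter \<open>\<lambda>\<^sub>i\<close> is the variance, whereas \<open>normal_density\<close> takes the standard
  deviation.
\<close>

definition truncated_prior :: "(nat \<Rightarrow> real) \<Rightarrow> real \<Rightarrow> (nat \<Rightarrow> real) measure" where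
  "truncated_prior lam k =
     restrict_space
       (\<Pi>\<^sub>M i\<in>{1..}. if real i \<le> k then density lborel (normal_density 0 (sqrt (lam i)))
                        else return borel 0)
       ell2"

text \<open>
  \<open>K\<close> is a version of the conditional distribution of the parameter given the observation,
  when the parameter \<open>f\<close> is drawn from \<open>Pri\<close> and the observation from \<open>P f\<close>:
  a Markov kernel such that \<open>E[1\<^sub>B(Y) K(Y, A)] = Pr(f \<in> A, Y \<in> B)\<close> under the joint law.
  It is unique only up to null sets of the marginal law of the observation.
\<close>

definition is_posterior ::
  "'a measure \<Rightarrow> 'b measure \<Rightarrow> ('a \<Rightarrow> 'b measure) \<Rightarrow> ('b \<Rightarrow> 'a measure) \<Rightarrow> bool" where
  "is_posterior Pri N P K \<longleftrightarrow>
     K \<in> N \<rightarrow>\<^sub>M prob_algebra Pri \<and>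
     (\<forall>A\<in>sets Pri. \<forall>B\<in>sets N.
        (\<integral>\<^sup>+ f. (\<integral>\<^sup>+ y. indicator B y * emeasure (K y) A \<partial>P f) \<partial>Pri) =
        (\<integral>\<^sup>+ f. indicator A f * emeasure (P f) B \<partial>Pri))"

end

theory Submission imports Defs begin

text \<open>
  Given the data, the coordinates of \<open>f\<close> are independent under the posterior, and the truncation
  level \<open>m\<close> (the integer part of \<open>k\<^sub>n\<close>) splits the loss in three parts. Write \<open>k = k\<^sub>n\<close> and
  \<open>a\<^sub>i = 1 / (1 + n \<kappa>\<^sub>i\<^sup>2 \<lambda>\<^sub>i)\<close>.

  \<^item> The coordinates after \<open>m\<close> are lost: the squared bias is at most \<open>R\<^sup>2 k\<^sup>-\<^sup>2\<^sup>\<beta>\<close> by smoothness.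
  \<^item> Shrinkage of the coordinate \<open>i \<le> m\<close> costs a squared bias \<open>a\<^sub>i\<^sup>2 f\<^sub>i\<^sup>2\<close>. The equation for \<open>k\<close>
    says that \<open>n \<kappa>\<^sub>i\<^sup>2 \<lambda>\<^sub>i\<close> is of order one at \<open>i = k\<close>, and it grows exponentially in \<open>k / i\<close> as
    \<open>i\<close> decreases. Hence \<open>a\<^sub>i \<le> B (i / k)\<^sup>\<beta>\<close>, and the sum is again at most \<open>B\<^sup>2 R\<^sup>2 k\<^sup>-\<^sup>2\<^sup>\<beta>\<close>.
  \<^item> The posterior variances \<open>\<lambda>\<^sub>i a\<^sub>i\<close> are at most \<open>1 / (n \<kappa>\<^sub>i\<^sup>2)\<close>, and for \<open>i \<le> k\<close> the equation
    for \<open>k\<close> makes this a multiple of \<open>exp (- \<xi> k)\<close> at most: their sum is exponentially small.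

  Since \<open>k\<close> is of order \<open>(log n)\<^sup>1\<^sup>/\<^sup>p\<close>, the mean square loss is of order
  \<open>(log n)\<^sup>-\<^sup>2\<^sup>\<beta>\<^sup>/\<^sup>p\<close>, and Markov's inequality gives contraction. These estimates are
  \<open>shrinkage_le\<close>, \<open>total_risk_le\<close> and \<open>truncation_point_rate\<close>.

  The posterior is an arbitrary kernel that satisfies Bayes' identity, so it is determined only up to
  null sets of the marginal law of the data under the prior, whereas the expectation is taken under
  the law given \<open>f\<^sub>0\<close>. Two facts bridge the gap. If a law has density \<open>q\<close> with respect to
  the marginal law, then Bayes' identity alone expresses the mean of the posterior mass of a set under
  that law as a prior integral of \<open>q\<close> (\<open>is_posterior_nn_integral\<close>); no version of the posterior has to
  be identified. When \<open>f\<^sub>0\<close> is cut off after finitely many coordinates, the density is a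
  finite product of ratios of normal densities, and everything reduces to one-dimensional conjugacy
  (\<open>gauss_posterior_risk\<close>, \<open>posterior_mass_head\<close>). The remaining coordinates of \<open>f\<^sub>0\<close> shift the data by a
  sequence whose norm is small compared with the standard deviation of the noise. A Kakutani-type estimate,
  \<open>Q(A)\<^sup>2 \<le> C T(A)\<close> for the two product measures, transfers the bound to \<open>f\<^sub>0\<close> itself
  (\<open>PiM_density_square_le\<close>, \<open>ex_head_square_le\<close>). The square costs a power of the bound, which
  is harmless because the bound tends to zero.
\<close>

section \<open>Finitely many coordinates of a product measure\<close>

text \<open>
  The integrand depends on the coordinates in \<open>J\<close> only, so that it can be integrated over the finite
  marginal on \<open>J\<close>, where Fubini's theorem factorizes it.
\<close>

lemma (in product_prob_space) nn_integral_PiM_finite_prod: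
  assumes J: "finite J" "J \<subseteq> I" and g: "\<And>i. i \<in> J \<Longrightarrow> g i \<in> borel_measurable (M i)"
  shows "(\<integral>\<^sup>+ x. (\<Prod>i\<in>J. g i (x i)) \<partial>PiM I M) = (\<Prod>i\<in>J. \<integral>\<^sup>+ t. g i t \<partial>M i)"
proof -
  have meas: "(\<lambda>x. \<Prod>i\<in>J. g i (x i)) \<in> borel_measurable (PiM J M)"
    using g by measurable
  have "(\<integral>\<^sup>+ x. (\<Prod>i\<in>J. g i (x i)) \<partial>PiM I M)
      = (\<integral>\<^sup>+ x. (\<Prod>i\<in>J. g i (restrict x J i)) \<partial>PiM I M)"
    by (intro nn_integral_cong prod.cong) auto
  also have "\<dots> = (\<integral>\<^sup>+ x. (\<Prod>i\<in>J. g i (x i)) \<partial>distr (PiM I M) (PiM J M) (\<lambda>x. restrict x J))"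
    using meas J by (intro nn_integral_distr[symmetric] measurable_restrict_subset) auto
  also have "\<dots> = (\<integral>\<^sup>+ x. (\<Prod>i\<in>J. g i (x i)) \<partial>PiM J M)"
    by (simp only: distr_PiM_restrict_finite[OF J])
  also have "\<dots> = (\<Prod>i\<in>J. \<integral>\<^sup>+ t. g i t \<partial>M i)"
    using J g by (intro product_nn_integral_prod) auto
  finally show ?thesis .
qed

lemma indicator_prod_emb:
  assumes "x \<in> space (PiM I M)" "K \<subseteq> I" "finite K"
  shows "indicator (prod_emb I M K (Pi\<^sub>E K F)) x = (\<Prod>i\<in>K. indicator (F i) (x i) :: ennreal)"
proof (cases "\<forall>i\<in>K. x i \<in> F i")
  case True
  then show ?thesis using assms by (simp add: prod_emb_iff space_PiM PiE_iff)
next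
  case False
  then have "x \<notin> prod_emb I M K (Pi\<^sub>E K F)"
    using assms by (auto simp: prod_emb_iff)
  moreover have "(\<Prod>i\<in>K. indicator (F i) (x i) :: ennreal) = 0"
    using False assms by (intro prod_zero) (auto simp: indicator_def)
  ultimately show ?thesis by simp
qed

text \<open>
  Densities on finitely many coordinates multiply to a density of the infinite product; for infinitely many
  coordinates the product of the densities need not define one. Both sides agree on finite-dimensional
  rectangles.
\<close>

lemma (in product_prob_space) density_PiM_finite_prod:
  assumes J: "finite J" "J \<subseteq> I" and r: "\<And>i. i \<in> J \<Longrightarrow> r i \<in> borel_measurable (M i)"
    and prob: "\<And>i. i \<in> J \<Longrightarrow> prob_space (density (M i) (r i))"
  shows "density (PiM I M) (\<lambda>x. \<Prod>i\<in>J. r i (x i)) =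
    PiM I (\<lambda>i. if i \<in> J then density (M i) (r i) else M i)"
proof -
  let ?D = "\<lambda>i. if i \<in> J then density (M i) (r i) else M i"
  have [measurable]: "(\<lambda>x. \<Prod>i\<in>J. r i (x i)) \<in> borel_measurable (PiM I M)"
  proof (intro borel_measurable_prod_ennreal)
    fix i assume i: "i \<in> J"
    with J have "i \<in> I" by auto
    show "(\<lambda>x. r i (x i)) \<in> borel_measurable (PiM I M)"
      using measurable_compose[OF measurable_component_singleton[of i I M] r[of i]] i \<open>i \<in> I\<close> by simp
  qed
  interpret D: product_prob_space ?D I
    using prob by (intro product_prob_spaceI) (auto intro: M.prob_space_axioms)
  have sets_D [simp]: "sets (?D i) = sets (M i)" for i by simp
  have space_D [simp]: "space (?D i) = space (M i)" for i by simp
  show ?thesis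
  proof (rule D.PiM_eq)
    show "sets (density (PiM I M) (\<lambda>x. \<Prod>i\<in>J. r i (x i))) = sets (PiM I ?D)"
      by (simp add: sets_PiM_cong[OF refl sets_D])
  next
    fix K F assume K: "finite K" "K \<subseteq> I" and F: "\<And>j. j \<in> K \<Longrightarrow> F j \<in> sets (?D j)"
    then have F': "F j \<in> sets (M j)" if "j \<in> K" for j using that by auto
    \<comment> \<open>The factor of the weight at \<open>i\<close> times the factor of the rectangle at \<open>i\<close>.\<close>
    define h where "h i t = (if i \<in> J then r i t else 1) * (if i \<in> K then indicator (F i) t else 1)"
      for i t
    have emb: "prod_emb I ?D K (Pi\<^sub>E K F) = emb I K (Pi\<^sub>E K F)"
      by (simp add: prod_emb_def)
    have hm: "h i \<in> borel_measurable (M i)" if "i \<in> J \<union> K" for i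
      using r[of i] F'[of i] unfolding h_def by (cases "i \<in> J"; cases "i \<in> K") auto
    have "emeasure (density (PiM I M) (\<lambda>x. \<Prod>i\<in>J. r i (x i))) (emb I K (Pi\<^sub>E K F)) =
        (\<integral>\<^sup>+ x. (\<Prod>i\<in>J. r i (x i)) * indicator (emb I K (Pi\<^sub>E K F)) x \<partial>PiM I M)"
      using K F' by (intro emeasure_density) (auto intro!: sets_PiM_I)
    also have "\<dots> = (\<integral>\<^sup>+ x. (\<Prod>i\<in>J\<union>K. h i (x i)) \<partial>PiM I M)"
    proof (intro nn_integral_cong)
      fix x assume x: "x \<in> space (PiM I M)"
      have "(\<Prod>i\<in>J. r i (x i)) = (\<Prod>i\<in>J\<union>K. if i \<in> J then r i (x i) else 1)"
        using J K by (intro prod.mono_neutral_cong_left) auto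
      moreover have "(\<Prod>i\<in>K. indicator (F i) (x i) :: ennreal)
          = (\<Prod>i\<in>J\<union>K. if i \<in> K then indicator (F i) (x i) else 1)"
        using J K by (intro prod.mono_neutral_cong_left) auto
      ultimately show "(\<Prod>i\<in>J. r i (x i)) * indicator (emb I K (Pi\<^sub>E K F)) x
          = (\<Prod>i\<in>J\<union>K. h i (x i))"
        unfolding indicator_prod_emb[OF x K(2,1)] h_def prod.distrib by simp
    qed
    also have "\<dots> = (\<Prod>i\<in>J\<union>K. \<integral>\<^sup>+ t. h i t \<partial>M i)"
      using J K hm by (intro nn_integral_PiM_finite_prod) auto
    also have "\<dots> = (\<Prod>i\<in>K. emeasure (?D i) (F i))"
    proof (intro prod.mono_neutral_cong_right ballI)
      fix i assume i: "i \<in> J \<union> K - K"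
      then have "(\<integral>\<^sup>+ t. h i t \<partial>M i) = emeasure (density (M i) (r i)) (space (M i))"
        using r[of i] by (subst emeasure_density) (auto simp: h_def intro!: nn_integral_cong)
      also have "\<dots> = 1"
        using prob_space.emeasure_space_1[OF prob[of i]] i by auto
      finally show "(\<integral>\<^sup>+ t. h i t \<partial>M i) = 1" .
    next
      fix i assume i: "i \<in> K"
      show "(\<integral>\<^sup>+ t. h i t \<partial>M i) = emeasure (?D i) (F i)"
        using r[of i] F'[OF i] i by (auto simp: h_def emeasure_density)
    qed (use J K in auto)
    finally show "emeasure (density (PiM I M) (\<lambda>x. \<Prod>i\<in>J. r i (x i)))
        (prod_emb I ?D K (Pi\<^sub>E K F)) = (\<Prod>j\<in>K. emeasure (?D j) (F j))"
      unfolding emb .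
  qed
qed

section \<open>Comparison of infinite product measures\<close>

text \<open>
  The sets that can be approximated for both measures at once form a \<open>\<sigma>\<close>-algebra. For a countable
  union, stop at a finite stage, which loses less than \<open>e / 2\<close> by continuity from below, and approximate
  each of the finitely many members so well that the errors add up to at most \<open>e / 2\<close>.
\<close>

lemma approx_by_generating_algebra:
  fixes M1 M2 :: "'a measure"
  assumes "finite_measure M1" "finite_measure M2" "algebra \<Omega> \<A>"
    and s1: "sets M1 = sigma_sets \<Omega> \<A>" and s2: "sets M2 = sigma_sets \<Omega> \<A>"
    and A: "A \<in> sets M1" and "e > 0"
  shows "\<exists>B\<in>\<A>. measure M1 (sym_diff A B) + measure M2 (sym_diff A B) < e"
proof -
  interpret M1: finite_measure M1 by fact
  interpret M2: finite_measure M2 by fact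
  interpret \<A>: algebra \<Omega> \<A> by fact
  define d where "d X = measure M1 X + measure M2 X" for X
  have A_sets: "B \<in> sets M1" "B \<in> sets M2" if "B \<in> \<A>" for B
    using that by (auto simp: s1 s2)
  have s12: "sets M2 = sets M1" by (simp add: s1 s2)
  have d_mono: "d X \<le> d Y" if "X \<subseteq> Y" "Y \<in> sets M1" for X Y
    unfolding d_def using that by (intro add_mono M1.finite_measure_mono M2.finite_measure_mono) (auto simp: s12)
  have d_sub: "d (X \<union> Y) \<le> d X + d Y" if "X \<in> sets M1" "Y \<in> sets M1" for X Y
    using measure_Un_le[of X M1 Y] measure_Un_le[of X M2 Y] that by (simp add: d_def s12)
  have "A \<in> sigma_sets \<Omega> \<A>" using A s1 by simp
  then have "\<forall>e>0. \<exists>B\<in>\<A>. d (sym_diff A B) < e"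
  proof induction
    case (Basic a)
    then show ?case by (intro allI impI bexI[of _ a]) (auto simp: d_def)
  next
    case Empty
    then show ?case by (intro allI impI bexI[of _ "{}"]) (auto simp: d_def)
  next
    case (Compl a)
    have "a \<subseteq> \<Omega>" using Compl.hyps sigma_sets_into_sp[OF \<A>.space_closed] by blast
    show ?case
    proof (intro allI impI)
      fix e :: real assume "e > 0"
      with Compl.IH obtain B where B: "B \<in> \<A>" "d (sym_diff a B) < e" by blast
      have "B \<subseteq> \<Omega>" using B(1) \<A>.space_closed by auto
      with \<open>a \<subseteq> \<Omega>\<close> have "sym_diff (\<Omega> - a) (\<Omega> - B) = sym_diff a B" by auto
      with B show "\<exists>B\<in>\<A>. d (sym_diff (\<Omega> - a) B) < e"
        by (intro bexI[of _ "\<Omega> - B"]) auto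
    qed
  next
    case (Union a)
    have a: "a i \<in> sets M1" for i using Union.hyps by (simp add: s1)
    show ?case
    proof (intro allI impI)
      fix e :: real assume e: "e > 0"
      let ?U = "\<lambda>n. \<Union>i<n. a i"
      have inc: "incseq ?U" by (auto simp: incseq_def) (meson lessThan_iff order_less_le_trans)
      have UU: "(\<Union>n. ?U n) = (\<Union>i. a i)" by auto
      have "(\<lambda>n. measure M1 (?U n)) \<longlonglongrightarrow> measure M1 (\<Union>i. a i)"
        using M1.finite_Lim_measure_incseq[OF _ inc] a unfolding UU by auto
      moreover have "(\<lambda>n. measure M2 (?U n)) \<longlonglongrightarrow> measure M2 (\<Union>i. a i)"
        using M2.finite_Lim_measure_incseq[OF _ inc] a unfolding UU by (auto simp: s12)
      ultimately have "(\<lambda>n. d (?U n)) \<longlonglongrightarrow> d (\<Union>i. a i)"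
        unfolding d_def by (intro tendsto_add)
      then have "\<forall>\<^sub>F n in sequentially. d (\<Union>i. a i) - e / 2 < d (?U n)"
        by (rule order_tendstoD) (use e in simp)
      then obtain n where n: "d (\<Union>i. a i) - e / 2 < d (?U n)"
        by (auto simp: eventually_sequentially)
      have rest: "d ((\<Union>i. a i) - ?U n) < e / 2"
      proof -
        have U: "(\<Union>i. a i) \<in> sets M1" "?U n \<in> sets M1" "?U n \<subseteq> (\<Union>i. a i)"
          using a by auto
        show ?thesis
          using n M1.finite_measure_Diff[OF U] M2.finite_measure_Diff[of "\<Union>i. a i" "?U n"] U
          by (simp add: d_def s12)
      qed
      define c where "c = e / (2 * (n + 1))"
      have c: "c > 0" "n * c \<le> e / 2" using e by (simp_all add: c_def field_simps)
      have "\<exists>B. \<forall>i. B i \<in> \<A> \<and> d (sym_diff (a i) (B i)) < c"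
        using Union.IH c(1) by (intro choice allI) blast
      then obtain B where B: "\<And>i. B i \<in> \<A>" "\<And>i. d (sym_diff (a i) (B i)) < c"
        by blast
      define V where "V i = sym_diff (a i) (B i)" for i
      have V: "V i \<in> sets M1" for i using a A_sets B(1) by (auto simp: V_def)
      have fin: "d (\<Union>i<m. V i) \<le> m * c" for m
      proof (induction m)
        case (Suc m)
        have "(\<Union>i<Suc m. V i) = (\<Union>i<m. V i) \<union> V m"
          by (simp add: lessThan_Suc Un_commute)
        then have "d (\<Union>i<Suc m. V i) \<le> d (\<Union>i<m. V i) + d (V m)"
          using d_sub[of "\<Union>i<m. V i" "V m"] V by auto
        also have "\<dots> \<le> real m * c + c"
          using Suc B(2)[of m] unfolding V_def[symmetric] by linarith
        also have "\<dots> = real (Suc m) * c" by (simp add: algebra_simps)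
        finally show ?case .
      qed (simp add: d_def)
      have BU: "(\<Union>i<n. B i) \<in> \<A>" using B(1) by (intro \<A>.finite_UN) auto
      have Um: "(\<Union>i. a i) - ?U n \<in> sets M1" "(\<Union>i<n. V i) \<in> sets M1"
        using a V by auto
      have "sym_diff (\<Union>i. a i) (\<Union>i<n. B i) \<subseteq> ((\<Union>i. a i) - ?U n) \<union> (\<Union>i<n. V i)"
        unfolding V_def by blast
      then have "d (sym_diff (\<Union>i. a i) (\<Union>i<n. B i)) \<le> d (((\<Union>i. a i) - ?U n) \<union> (\<Union>i<n. V i))"
        using Um by (intro d_mono sets.Un)
      also have "\<dots> \<le> d ((\<Union>i. a i) - ?U n) + d (\<Union>i<n. V i)"
        using Um by (rule d_sub)
      also have "\<dots> < e / 2 + e / 2"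
        by (intro add_less_le_mono rest order_trans[OF fin] c)
      also have "\<dots> = e" by simp
      finally show "\<exists>B\<in>\<A>. d (sym_diff (\<Union>i. a i) B) < e" using BU by auto
    qed
  qed
  with \<open>e > 0\<close> show ?thesis by (auto simp: d_def)
qed

text \<open>
  A quantitative form of one half of Kakutani's theorem. On a cylinder over \<open>J\<close> the measure on the left has
  the density \<open>\<Prod>i\<in>J. r i\<close>, and the Cauchy--Schwarz inequality bounds the square of its mass by the
  chi-square integral times the mass of the measure on the right. The bound does not depend on \<open>J\<close> and concerns
  the values of the two measures only, so that it passes to all measurable sets by approximation, and the
  infinite product of the \<open>r i\<close> never has to be constructed.
\<close>

lemma PiM_density_square_le:
  assumes "product_prob_space T"
    and r: "\<And>i. r i \<in> borel_measurable (T i)"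
    and prob: "\<And>i. prob_space (density (T i) (r i))"
    and C: "\<And>J. finite J \<Longrightarrow> J \<subseteq> I \<Longrightarrow> (\<Prod>i\<in>J. \<integral>\<^sup>+ t. (r i t)\<^sup>2 \<partial>T i) \<le> ennreal C" "C \<ge> 0"
    and A: "A \<in> sets (PiM I T)"
  shows "(measure (PiM I (\<lambda>i. density (T i) (r i))) A)\<^sup>2 \<le> C * measure (PiM I T) A"
proof -
  interpret T: product_prob_space T I by fact
  let ?Q = "\<lambda>i. density (T i) (r i)"
  interpret Q: product_prob_space ?Q I using prob by (intro product_prob_spaceI) auto
  have sets_Q: "sets (PiM J ?Q) = sets (PiM J T)" for J by (intro sets_PiM_cong) auto
  have emb_Q: "prod_emb I ?Q J X = prod_emb I T J X" for J X by (simp add: prod_emb_def)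
  have cyl: "(measure (PiM I ?Q) B)\<^sup>2 \<le> C * measure (PiM I T) B" if B: "B \<in> T.generator" for B
    using B
  proof cases
    case (1 J X)
    let ?D = "\<lambda>i. if i \<in> J then density (T i) (r i) else T i"
    interpret D: product_prob_space ?D I
      using prob by (intro product_prob_spaceI) (auto intro: T.M.prob_space_axioms)
    have dens: "density (PiM I T) (\<lambda>x. \<Prod>i\<in>J. r i (x i)) = PiM I ?D"
      using 1 r prob by (intro T.density_PiM_finite_prod) auto
    have rm: "(\<lambda>x. \<Prod>i\<in>J. r i (x i)) \<in> borel_measurable (PiM I T)"
    proof (intro borel_measurable_prod_ennreal)
      fix i assume "i \<in> J"
      with 1 have "i \<in> I" by auto
      then show "(\<lambda>x. r i (x i)) \<in> borel_measurable (PiM I T)"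
        using measurable_compose[OF measurable_component_singleton[of i I T] r[of i]] by simp
    qed
    have Bs: "B \<in> sets (PiM I T)" using 1 by auto
    have space_D: "space (?D i) = space (T i)" for i by simp
    have emb_D: "prod_emb I ?D J X = prod_emb I T J X" unfolding prod_emb_def space_D ..
    have XD: "X \<in> sets (PiM J ?D)" "X \<in> sets (PiM J ?Q)"
      using 1 by (auto cong: sets_PiM_cong)
    have "emeasure (PiM I ?Q) B = emeasure (PiM J ?Q) X"
      using Q.emeasure_PiM_emb'[OF 1(3,2) XD(2)] unfolding 1(1) emb_Q by simp
    also have "PiM J ?Q = PiM J ?D" by (intro PiM_cong) auto
    also have "emeasure (PiM J ?D) X = emeasure (PiM I ?D) B"
      using D.emeasure_PiM_emb'[OF 1(3,2) XD(1)] unfolding 1(1) emb_D by simp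
    also have "\<dots> = (\<integral>\<^sup>+ x. (\<Prod>i\<in>J. r i (x i)) * indicator B x \<partial>PiM I T)"
      unfolding dens[symmetric] by (intro emeasure_density rm Bs)
    finally have "(emeasure (PiM I ?Q) B)\<^sup>2
        \<le> (\<integral>\<^sup>+ x. (\<Prod>i\<in>J. r i (x i))\<^sup>2 \<partial>PiM I T) * (\<integral>\<^sup>+ x. (indicator B x)\<^sup>2 \<partial>PiM I T)"
      using Cauchy_Schwarz_nn_integral[OF rm, of "indicator B"] Bs by simp
    also have "(\<integral>\<^sup>+ x. (\<Prod>i\<in>J. r i (x i))\<^sup>2 \<partial>PiM I T) = (\<Prod>i\<in>J. \<integral>\<^sup>+ t. (r i t)\<^sup>2 \<partial>T i)"
      using 1 r by (subst T.nn_integral_PiM_finite_prod[symmetric])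
        (auto simp: prod_power_distrib)
    also have "(\<integral>\<^sup>+ x. (indicator B x)\<^sup>2 \<partial>PiM I T) = emeasure (PiM I T) B"
    proof -
      have "(indicator B x :: ennreal)\<^sup>2 = indicator B x" for x by (simp split: split_indicator)
      then show ?thesis using Bs by simp
    qed
    also have "(\<Prod>i\<in>J. \<integral>\<^sup>+ t. (r i t)\<^sup>2 \<partial>T i) * emeasure (PiM I T) B \<le> C * emeasure (PiM I T) B"
      using C 1 by (intro mult_right_mono) auto
    finally show ?thesis
      unfolding Q.P.emeasure_eq_measure T.P.emeasure_eq_measure
      by (simp add: ennreal_power ennreal_mult[symmetric] C(2))
  qed
  have lim: "measure (PiM I ?Q) A \<le> sqrt (C * (measure (PiM I T) A + e)) + e" if "e > 0" for e
  proof -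
    have gen: "sets (PiM I T) = sigma_sets (space (PiM I T)) T.generator"
      by (rule T.sets_PiM_generator)
    obtain B where B: "B \<in> T.generator"
      "measure (PiM I ?Q) (sym_diff A B) + measure (PiM I T) (sym_diff A B) < e"
      using approx_by_generating_algebra[OF Q.P.finite_measure_axioms T.P.finite_measure_axioms
          T.algebra_generator _ gen, of A e] A \<open>e > 0\<close>
      unfolding sets_Q using gen by blast
    have Bs: "B \<in> sets (PiM I T)" using B(1) gen by auto
    note m = A Bs A[folded sets_Q] Bs[folded sets_Q]
    have nn: "measure (PiM I ?Q) (sym_diff A B) \<ge> 0" "measure (PiM I T) (sym_diff A B) \<ge> 0" by auto
    have "measure (PiM I ?Q) A \<le> measure (PiM I ?Q) (B \<union> sym_diff A B)"
      using m by (intro Q.P.finite_measure_mono) auto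
    also have "\<dots> \<le> measure (PiM I ?Q) B + measure (PiM I ?Q) (sym_diff A B)"
      using m by (intro measure_Un_le) auto
    finally have 1: "measure (PiM I ?Q) A \<le> measure (PiM I ?Q) B + e" using B(2) nn by linarith
    have "measure (PiM I T) B \<le> measure (PiM I T) (A \<union> sym_diff A B)"
      using m by (intro T.P.finite_measure_mono) auto
    also have "\<dots> \<le> measure (PiM I T) A + measure (PiM I T) (sym_diff A B)"
      using m by (intro measure_Un_le) auto
    finally have 2: "measure (PiM I T) B \<le> measure (PiM I T) A + e" using B(2) nn by linarith
    have "measure (PiM I ?Q) B \<le> sqrt (C * measure (PiM I T) B)"
      using cyl[OF B(1)] by (rule real_le_rsqrt)
    also have "\<dots> \<le> sqrt (C * (measure (PiM I T) A + e))"
      using 2 C(2) by (intro real_sqrt_le_mono mult_left_mono)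
    finally show ?thesis using 1 by linarith
  qed
  have "((\<lambda>e. sqrt (C * (measure (PiM I T) A + e)) + e)
      \<longlongrightarrow> sqrt (C * (measure (PiM I T) A + 0)) + 0) (at_right 0)"
    by (intro tendsto_intros)
  then have "measure (PiM I ?Q) A \<le> sqrt (C * (measure (PiM I T) A + 0)) + 0"
    by (rule tendsto_lowerbound) (auto intro!: eventually_at_right_less[THEN eventually_mono] lim)
  then have "(measure (PiM I ?Q) A)\<^sup>2 \<le> (sqrt (C * measure (PiM I T) A))\<^sup>2"
    by (intro power_mono) auto
  then show ?thesis using C(2) by simp
qed

text \<open>
  Away from a set \<open>E\<close> the function is at most \<open>t\<close>. Markov's inequality bounds the mass of \<open>E\<close> under \<open>T\<close>,
  hence the hypothesis bounds it under \<open>Q\<close>.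
\<close>

lemma nn_integral_le_of_square_le:
  assumes "prob_space Q" "prob_space T" and sets: "sets Q = sets T"
    and sq: "\<And>A. A \<in> sets T \<Longrightarrow> (measure Q A)\<^sup>2 \<le> C * measure T A" and "C \<ge> 0"
    and \<phi>: "\<phi> \<in> borel_measurable T" "\<And>y. \<phi> y \<le> 1"
    and \<delta>: "(\<integral>\<^sup>+ y. \<phi> y \<partial>T) \<le> ennreal \<delta>" "\<delta> \<ge> 0" and "t > 0"
  shows "(\<integral>\<^sup>+ y. \<phi> y \<partial>Q) \<le> ennreal (t + sqrt (C * (\<delta> / t)))"
proof -
  interpret Q: prob_space Q by fact
  interpret T: prob_space T by fact
  have [measurable]: "\<phi> \<in> borel_measurable T" "\<phi> \<in> borel_measurable Q"
    using \<phi> by (simp_all cong: measurable_cong_sets add: measurable_cong_sets[OF sets refl])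
  define E where "E = {y \<in> space T. 1 \<le> ennreal (1 / t) * \<phi> y}"
  have E [measurable]: "E \<in> sets T" unfolding E_def by measurable
  have sp: "space Q = space T" using sets by (rule sets_eq_imp_space_eq)
  have "emeasure T E \<le> ennreal (1 / t) * (\<integral>\<^sup>+ y. \<phi> y * indicator (space T) y \<partial>T)"
    unfolding E_def by (rule order_trans[OF _ nn_integral_Markov_inequality]) (auto simp: \<phi>)
  also have "(\<integral>\<^sup>+ y. \<phi> y * indicator (space T) y \<partial>T) = (\<integral>\<^sup>+ y. \<phi> y \<partial>T)"
    by (intro nn_integral_cong) auto
  also have "ennreal (1 / t) * (\<integral>\<^sup>+ y. \<phi> y \<partial>T) \<le> ennreal (1 / t) * ennreal \<delta>"
    by (intro mult_left_mono \<delta>) auto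
  finally have TE: "measure T E \<le> \<delta> / t"
    using \<open>t > 0\<close> \<delta>(2) by (simp add: T.emeasure_eq_measure ennreal_mult[symmetric])
  have "measure Q E \<le> sqrt (C * measure T E)"
    using sq[OF E] by (rule real_le_rsqrt)
  also have "\<dots> \<le> sqrt (C * (\<delta> / t))"
    using TE \<open>C \<ge> 0\<close> by (intro real_sqrt_le_mono mult_left_mono)
  finally have QE: "measure Q E \<le> sqrt (C * (\<delta> / t))" .
  have "(\<integral>\<^sup>+ y. \<phi> y \<partial>Q) \<le> (\<integral>\<^sup>+ y. ennreal t + indicator E y \<partial>Q)"
  proof (intro nn_integral_mono)
    fix y assume y: "y \<in> space Q"
    show "\<phi> y \<le> ennreal t + indicator E y"
    proof (cases "y \<in> E")
      case True
      then show ?thesis using \<phi>(2)[of y] by (auto intro: order_trans add_increasing)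
    next
      case False
      then have "ennreal (1 / t) * \<phi> y < 1" using y sp by (auto simp: E_def)
      then have "ennreal t * (ennreal (1 / t) * \<phi> y) \<le> ennreal t * 1"
        by (intro mult_left_mono) auto
      then have "\<phi> y \<le> ennreal t"
        using \<open>t > 0\<close> by (simp add: mult.assoc[symmetric] ennreal_mult[symmetric])
      then show ?thesis by (simp add: False)
    qed
  qed
  also have "\<dots> = ennreal t + emeasure Q E"
    using E sets by (subst nn_integral_add) (auto simp: Q.emeasure_space_1)
  also have "\<dots> = ennreal (t + measure Q E)"
    using \<open>t > 0\<close> by (simp add: Q.emeasure_eq_measure ennreal_plus[symmetric] del: ennreal_plus)
  also have "\<dots> \<le> ennreal (t + sqrt (C * (\<delta> / t)))"
    using QE by (intro ennreal_leI) simp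
  finally show ?thesis .
qed

section \<open>Bayes' identity for integrals\<close>

text \<open>
  For an indicator \<open>q\<close> this is the definition of a posterior. In general, the two sides are integrals of
  \<open>q\<close> against two measures on \<open>N\<close>, which agree by that definition. With \<open>q\<close> the density of some law
  with respect to the marginal law \<open>Pri \<bind> P\<close>, the left-hand side is the mean of \<open>K y A\<close> under this law,
  for every version \<open>K\<close> of the posterior.
\<close>

lemma is_posterior_nn_integral:
  assumes post: "is_posterior Pri N P K" and P: "P \<in> Pri \<rightarrow>\<^sub>M subprob_algebra N"
    and ne: "space Pri \<noteq> {}" and A: "A \<in> sets Pri" and q: "q \<in> borel_measurable N"
  shows "(\<integral>\<^sup>+ y. q y * emeasure (K y) A \<partial>(Pri \<bind> P)) =
    (\<integral>\<^sup>+ f. indicator A f * (\<integral>\<^sup>+ y. q y \<partial>P f) \<partial>Pri)"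
proof -
  have K: "K \<in> N \<rightarrow>\<^sub>M subprob_algebra Pri"
    using post by (auto simp: is_posterior_def intro: measurable_prob_algebraD)
  have KA [measurable]: "(\<lambda>y. emeasure (K y) A) \<in> borel_measurable N"
    using measurable_compose[OF K measurable_emeasure_subprob_algebra[OF A]] .
  have sets_marg: "sets (Pri \<bind> P) = sets N"
    by (rule sets_bind[OF sets_kernel[OF P] ne])
  let ?PA = "density Pri (indicator A)"
  have P': "P \<in> ?PA \<rightarrow>\<^sub>M subprob_algebra N" using P by simp
  have sets_marg': "sets (?PA \<bind> P) = sets N"
    using ne by (intro sets_bind[OF sets_kernel[OF P']]) auto
  have "density (Pri \<bind> P) (\<lambda>y. emeasure (K y) A) = ?PA \<bind> P"
  proof (rule measure_eqI)
    show "sets (density (Pri \<bind> P) (\<lambda>y. emeasure (K y) A)) = sets (?PA \<bind> P)"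
      by (simp add: sets_marg sets_marg')
    fix B assume "B \<in> sets (density (Pri \<bind> P) (\<lambda>y. emeasure (K y) A))"
    then have B: "B \<in> sets N" by (simp add: sets_marg)
    have "emeasure (density (Pri \<bind> P) (\<lambda>y. emeasure (K y) A)) B
        = (\<integral>\<^sup>+ y. emeasure (K y) A * indicator B y \<partial>(Pri \<bind> P))"
      using B KA by (intro emeasure_density) (auto simp: sets_marg cong: measurable_cong_sets)
    also have "\<dots> = (\<integral>\<^sup>+ f. (\<integral>\<^sup>+ y. indicator B y * emeasure (K y) A \<partial>P f) \<partial>Pri)"
      using B KA by (subst nn_integral_bind[OF _ P]) (auto simp: mult.commute)
    also have "\<dots> = (\<integral>\<^sup>+ f. indicator A f * emeasure (P f) B \<partial>Pri)"
      using post A B by (auto simp: is_posterior_def)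
    also have "\<dots> = (\<integral>\<^sup>+ f. emeasure (P f) B \<partial>?PA)"
      using A B measurable_compose[OF P measurable_emeasure_subprob_algebra[OF B]]
      by (subst nn_integral_density) auto
    also have "\<dots> = emeasure (?PA \<bind> P) B"
      using ne B by (intro emeasure_bind[OF _ P', symmetric]) auto
    finally show "emeasure (density (Pri \<bind> P) (\<lambda>y. emeasure (K y) A)) B = emeasure (?PA \<bind> P) B" .
  qed
  then have "(\<integral>\<^sup>+ y. q y \<partial>density (Pri \<bind> P) (\<lambda>y. emeasure (K y) A)) = (\<integral>\<^sup>+ y. q y \<partial>(?PA \<bind> P))"
    by simp
  also have "(\<integral>\<^sup>+ y. q y \<partial>density (Pri \<bind> P) (\<lambda>y. emeasure (K y) A))
      = (\<integral>\<^sup>+ y. q y * emeasure (K y) A \<partial>(Pri \<bind> P))"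
    using q KA by (subst nn_integral_density)
      (auto simp: sets_marg mult.commute cong: measurable_cong_sets)
  also have "(\<integral>\<^sup>+ y. q y \<partial>(?PA \<bind> P)) = (\<integral>\<^sup>+ f. (\<integral>\<^sup>+ y. q y \<partial>P f) \<partial>?PA)"
    by (rule nn_integral_bind[OF q P'])
  also have "\<dots> = (\<integral>\<^sup>+ f. indicator A f * (\<integral>\<^sup>+ y. q y \<partial>P f) \<partial>Pri)"
    using A measurable_compose[OF P nn_integral_measurable_subprob_algebra[OF q]]
    by (subst nn_integral_density) auto
  finally show ?thesis .
qed

section \<open>One-dimensional normal conjugacy\<close>

text \<open>
  The normal law with mean \<open>m\<close> and variance \<open>v\<close>, where \<open>v = 0\<close> is allowed: a coordinate after the
  truncation point then is an ordinary coordinate with prior variance zero, and the formulas below cover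
  both cases.
\<close>

definition gauss :: "real \<Rightarrow> real \<Rightarrow> real measure" where
  "gauss m v = distr (density lborel std_normal_density) borel (\<lambda>z. m + sqrt v * z)"

lemma sets_gauss [simp, measurable_cong]: "sets (gauss m v) = sets borel"
  and space_gauss [simp]: "space (gauss m v) = UNIV"
  by (simp_all add: gauss_def)

lemma prob_space_gauss: "prob_space (gauss m v)"
  unfolding gauss_def
  by (rule prob_space.prob_space_distr[OF prob_space_normal_density]) auto

lemma gauss_0: "gauss m 0 = return borel m"
proof -
  interpret prob_space "density lborel std_normal_density"
    by (rule prob_space_normal_density) simp
  show ?thesis by (simp add: gauss_def distr_const)
qed

lemma gauss_eq_density:
  assumes "v > 0"
  shows "gauss m v = density lborel (normal_density m (sqrt v))"
proof -
  interpret prob_space "density lborel std_normal_density"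
    by (rule prob_space_normal_density) simp
  have "distributed (density lborel std_normal_density) lborel (\<lambda>z. z) (normal_density 0 1)"
    by (simp add: distributed_def distr_id2)
  from normal_density_affine[OF this, of "sqrt v" m] assms
  show ?thesis by (simp add: distributed_def gauss_def) (metis distr_cong sets_lborel)
qed

lemma measurable_gauss_param:
  "a \<in> borel_measurable N \<Longrightarrow> (\<lambda>x. gauss (a x) v) \<in> N \<rightarrow>\<^sub>M subprob_algebra borel"
proof -
  assume [measurable]: "a \<in> borel_measurable N"
  interpret prob_space "density lborel std_normal_density"
    by (rule prob_space_normal_density) simp
  show ?thesis unfolding gauss_def
    by (rule measurable_distr2[where M="density lborel std_normal_density"])
      (auto intro!: measurable_const M_in_subprob)
qed

lemma nn_integral_gauss:
  fixes h :: "real \<Rightarrow> ennreal"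
  assumes "h \<in> borel_measurable borel" "v > 0"
  shows "(\<integral>\<^sup>+ x. h x \<partial>gauss m v) = (\<integral>\<^sup>+ x. normal_density m (sqrt v) x * h x \<partial>lborel)"
  using assms by (simp add: gauss_eq_density nn_integral_density)

lemma gauss_second_moment:
  assumes "v \<ge> 0"
  shows "(\<integral>\<^sup>+ x. ennreal ((a * x + b)\<^sup>2) \<partial>gauss m v) = ennreal ((a * m + b)\<^sup>2 + a\<^sup>2 * v)"
proof -
  let ?c = "a * m + b" and ?d = "a * sqrt v"
  have 0: "has_bochner_integral lborel (\<lambda>z. std_normal_density z * z ^ (2 * 0)) 1"
    using std_normal_moment_even[of 0] by simp
  have 1: "has_bochner_integral lborel (\<lambda>z. std_normal_density z * z ^ (2 * 0 + 1)) 0"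
    by (rule std_normal_moment_odd)
  have 2: "has_bochner_integral lborel (\<lambda>z. std_normal_density z * z ^ (2 * 1)) 1"
    using std_normal_moment_even[of 1] by (simp add: fact_numeral)
  have "has_bochner_integral lborel (\<lambda>z. ?c\<^sup>2 * (std_normal_density z * z ^ (2 * 0))
      + 2 * ?c * ?d * (std_normal_density z * z ^ (2 * 0 + 1))
      + ?d\<^sup>2 * (std_normal_density z * z ^ (2 * 1))) (?c\<^sup>2 * 1 + 2 * ?c * ?d * 0 + ?d\<^sup>2 * 1)"
    by (intro has_bochner_integral_add has_bochner_integral_mult_right 0 1 2)
  also have "(\<lambda>z. ?c\<^sup>2 * (std_normal_density z * z ^ (2 * 0))
      + 2 * ?c * ?d * (std_normal_density z * z ^ (2 * 0 + 1))
      + ?d\<^sup>2 * (std_normal_density z * z ^ (2 * 1)))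
      = (\<lambda>z. std_normal_density z * (a * (m + sqrt v * z) + b)\<^sup>2)"
    by (simp add: fun_eq_iff power2_eq_square algebra_simps)
  finally have B: "has_bochner_integral lborel
      (\<lambda>z. std_normal_density z * (a * (m + sqrt v * z) + b)\<^sup>2) (?c\<^sup>2 + a\<^sup>2 * v)"
    using assms by (simp add: power_mult_distrib)
  have "(\<integral>\<^sup>+ x. ennreal ((a * x + b)\<^sup>2) \<partial>gauss m v)
      = (\<integral>\<^sup>+ z. ennreal (std_normal_density z * (a * (m + sqrt v * z) + b)\<^sup>2) \<partial>lborel)"
    unfolding gauss_def
    by (subst nn_integral_distr) (auto simp: nn_integral_density ennreal_mult)
  also have "\<dots> = ennreal (?c\<^sup>2 + a\<^sup>2 * v)"
    using B assms by (subst nn_integral_eq_integral) (auto simp: has_bochner_integral_iff)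
  finally show ?thesis .
qed

lemma gauss_density_ratio:
  assumes "v > 0" "w > 0"
  shows "gauss m v = density (gauss m' w)
    (\<lambda>x. ennreal (normal_density m (sqrt v) x / normal_density m' (sqrt w) x))"
proof -
  have "normal_density m' (sqrt w) x > 0" for x
    using assms by (intro normal_density_pos) simp
  then have "normal_density m' (sqrt w) x \<noteq> 0" for x by (metis less_irrefl)
  then show ?thesis using assms
    by (simp add: gauss_eq_density density_density_eq ennreal_mult[symmetric])
qed

text \<open>
  Completing the square turns the squared ratio, weighted by the centred density, into a multiple of the normal density with mean \<open>2 * m\<close>.
\<close>

lemma gauss_shift_chi_square:
  assumes "v > 0"
  shows "(\<integral>\<^sup>+ x. (ennreal (normal_density m (sqrt v) x / normal_density 0 (sqrt v) x))\<^sup>2 \<partial>gauss 0 v)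
    = ennreal (exp (m\<^sup>2 / v))"
proof -
  have eq: "normal_density 0 (sqrt v) x * (normal_density m (sqrt v) x / normal_density 0 (sqrt v) x)\<^sup>2
      = exp (m\<^sup>2 / v) * normal_density (2 * m) (sqrt v) x" for x
  proof -
    let ?Z = "sqrt (2 * pi * v)"
    have Z: "?Z > 0" using assms by simp
    have cancel: "1 / ?Z * B * ((1 / ?Z * A) / (1 / ?Z * B))\<^sup>2 = 1 / ?Z * (A * A / B)"
      if "B > 0" for A B :: real
      using Z that by (simp add: power2_eq_square field_simps)
    have "normal_density 0 (sqrt v) x * (normal_density m (sqrt v) x / normal_density 0 (sqrt v) x)\<^sup>2
        = 1 / ?Z * (exp (- (x - m)\<^sup>2 / (2 * v)) * exp (- (x - m)\<^sup>2 / (2 * v)) / exp (- x\<^sup>2 / (2 * v)))"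
      using cancel[of "exp (- x\<^sup>2 / (2 * v))" "exp (- (x - m)\<^sup>2 / (2 * v))"] assms
      by (simp add: normal_density_def)
    also have "\<dots> = 1 / ?Z * exp (- (x - m)\<^sup>2 / (2 * v) + - (x - m)\<^sup>2 / (2 * v) - - x\<^sup>2 / (2 * v))"
      by (simp only: exp_add exp_diff)
    also have "- (x - m)\<^sup>2 / (2 * v) + - (x - m)\<^sup>2 / (2 * v) - - x\<^sup>2 / (2 * v)
        = m\<^sup>2 / v + - (x - 2 * m)\<^sup>2 / (2 * v)"
      using assms by (simp add: field_simps power2_eq_square)
    also have "1 / ?Z * exp (m\<^sup>2 / v + - (x - 2 * m)\<^sup>2 / (2 * v))
        = exp (m\<^sup>2 / v) * normal_density (2 * m) (sqrt v) x"
      unfolding exp_add using assms by (simp add: normal_density_def)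
    finally show ?thesis .
  qed
  have "(\<integral>\<^sup>+ x. (ennreal (normal_density m (sqrt v) x / normal_density 0 (sqrt v) x))\<^sup>2 \<partial>gauss 0 v)
      = (\<integral>\<^sup>+ x. ennreal (exp (m\<^sup>2 / v)) * ennreal (normal_density (2 * m) (sqrt v) x) \<partial>lborel)"
    using assms
    by (subst nn_integral_gauss) (auto simp: ennreal_power ennreal_mult[symmetric] eq)
  also have "\<dots> = ennreal (exp (m\<^sup>2 / v)) * emeasure (gauss (2 * m) v) UNIV"
    using assms by (simp add: nn_integral_cmult gauss_eq_density emeasure_density)
  also have "emeasure (gauss (2 * m) v) UNIV = 1"
    using prob_space.emeasure_space_1[OF prob_space_gauss[of "2 * m" v]] by simp
  finally show ?thesis by simp
qed

text \<open>
  Completing the square in \<open>\<theta>\<close> factorizes the joint density of parameter and observation into the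
  marginal density of the observation and the posterior density of the parameter.
\<close>

lemma normal_density_bayes:
  fixes \<kappa> l s y \<theta> :: real
  assumes "l > 0" "s > 0"
  defines "w \<equiv> \<kappa>\<^sup>2 * l + s"
  shows "normal_density (\<kappa> * \<theta>) (sqrt s) y * normal_density 0 (sqrt l) \<theta>
    = normal_density 0 (sqrt w) y * normal_density (\<kappa> * l / w * y) (sqrt (l * s / w)) \<theta>"
proof -
  have w: "w > 0" using assms by (auto simp: w_def intro: add_nonneg_pos)
  have Z: "sqrt (2 * pi * s) * sqrt (2 * pi * l) = sqrt (2 * pi * w) * sqrt (2 * pi * (l * s / w))"
    unfolding real_sqrt_mult[symmetric] using w by (simp add: field_simps)
  have E: "- (y - \<kappa> * \<theta>)\<^sup>2 / (2 * s) + - \<theta>\<^sup>2 / (2 * l)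
      = - y\<^sup>2 / (2 * w) + - (\<theta> - \<kappa> * l / w * y)\<^sup>2 / (2 * (l * s / w))"
  proof -
    have "(\<theta> - \<kappa> * l / w * y) = (w * \<theta> - \<kappa> * l * y) / w" using w by (simp add: field_simps)
    then have "- (\<theta> - \<kappa> * l / w * y)\<^sup>2 / (2 * (l * s / w)) = - (w * \<theta> - \<kappa> * l * y)\<^sup>2 / (2 * l * s * w)"
      using w assms(1,2) by (simp add: power_divide) (simp add: power2_eq_square field_simps)
    moreover have "w * (l * (y - \<kappa> * \<theta>)\<^sup>2 + s * \<theta>\<^sup>2) = l * s * y\<^sup>2 + (w * \<theta> - \<kappa> * l * y)\<^sup>2"
      unfolding w_def by (simp add: algebra_simps power2_eq_square)
    moreover have "- X / (2 * s) + - T / (2 * l) = - (w * (l * X + s * T)) / (2 * l * s * w)"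
      and "- Y / (2 * w) + - U / (2 * l * s * w) = - (l * s * Y + U) / (2 * l * s * w)" for X T Y U :: real
      using w assms(1,2) by (simp_all add: field_simps)
    ultimately show ?thesis by presburger
  qed
  have "normal_density (\<kappa> * \<theta>) (sqrt s) y * normal_density 0 (sqrt l) \<theta>
      = 1 / (sqrt (2 * pi * s) * sqrt (2 * pi * l)) * exp (- (y - \<kappa> * \<theta>)\<^sup>2 / (2 * s) + - \<theta>\<^sup>2 / (2 * l))"
    unfolding exp_add using assms(1,2) by (simp add: normal_density_def)
  also have "\<dots> = normal_density 0 (sqrt w) y * normal_density (\<kappa> * l / w * y) (sqrt (l * s / w)) \<theta>"
    unfolding Z E exp_add using w assms(1,2) by (simp add: normal_density_def)
  finally show ?thesis .
qed

text \<open>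
  Bayes' formula in integrated form, by Fubini's theorem. A degenerate prior has no Lebesgue density, but
  then both sides are integrals of \<open>h 0\<close>.
\<close>

lemma gauss_disintegration:
  fixes \<kappa> l s :: real and h :: "real \<Rightarrow> real \<Rightarrow> ennreal"
  assumes l: "l \<ge> 0" and s: "s > 0" and h: "case_prod h \<in> borel_measurable (borel \<Otimes>\<^sub>M borel)"
  defines "w \<equiv> \<kappa>\<^sup>2 * l + s"
  shows "(\<integral>\<^sup>+ \<theta>. \<integral>\<^sup>+ y. h \<theta> y \<partial>gauss (\<kappa> * \<theta>) s \<partial>gauss 0 l)
    = (\<integral>\<^sup>+ y. \<integral>\<^sup>+ \<theta>. h \<theta> y \<partial>gauss (\<kappa> * l / w * y) (l * s / w) \<partial>gauss 0 w)"
proof -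
  have [measurable]: "(\<lambda>y. h (f y) (g y)) \<in> borel_measurable M"
    if "f \<in> borel_measurable M" "g \<in> borel_measurable M" for f g and M :: "'z measure"
    using measurable_compose[OF measurable_Pair[OF that] h] by simp
  have h1: "(\<lambda>y. h \<theta> y) \<in> borel_measurable borel" "(\<lambda>x. h x \<theta>) \<in> borel_measurable borel" for \<theta>
    by measurable
  have w: "w > 0" using assms by (auto simp: w_def intro: add_nonneg_pos)
  have m1: "(\<lambda>\<theta>. \<integral>\<^sup>+ y. h \<theta> y \<partial>gauss (\<kappa> * \<theta>) s) \<in> borel_measurable borel"
    by (rule nn_integral_measurable_subprob_algebra2[where N=borel])
       (auto intro!: measurable_gauss_param h)
  have m2: "(\<lambda>y. \<integral>\<^sup>+ \<theta>. h \<theta> y \<partial>gauss (\<kappa> * l / w * y) (l * s / w)) \<in> borel_measurable borel"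
    by (rule nn_integral_measurable_subprob_algebra2[where N=borel])
       (auto intro!: measurable_gauss_param simp: case_prod_unfold)
  show ?thesis
  proof (cases "l = 0")
    case True
    then have "w = s" by (simp add: w_def)
    have "(\<integral>\<^sup>+ \<theta>. \<integral>\<^sup>+ y. h \<theta> y \<partial>gauss (\<kappa> * \<theta>) s \<partial>gauss 0 0) = (\<integral>\<^sup>+ y. h 0 y \<partial>gauss 0 s)"
      unfolding gauss_0 using m1 by (simp add: nn_integral_return)
    moreover have "(\<integral>\<^sup>+ \<theta>. h \<theta> y \<partial>gauss 0 0) = h 0 y" for y
      unfolding gauss_0 using h1 by (simp add: nn_integral_return)
    ultimately show ?thesis using True \<open>w = s\<close> by simp
  next
    case False
    with l have l: "l > 0" by simp
    have v: "l * s / w > 0" using l s w by simp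
    have "(\<integral>\<^sup>+ \<theta>. \<integral>\<^sup>+ y. h \<theta> y \<partial>gauss (\<kappa> * \<theta>) s \<partial>gauss 0 l)
        = (\<integral>\<^sup>+ \<theta>. normal_density 0 (sqrt l) \<theta> * (\<integral>\<^sup>+ y. h \<theta> y \<partial>gauss (\<kappa> * \<theta>) s) \<partial>lborel)"
      by (rule nn_integral_gauss[OF m1 l])
    also have "\<dots> = (\<integral>\<^sup>+ \<theta>. \<integral>\<^sup>+ y. normal_density 0 (sqrt l) \<theta> * (normal_density (\<kappa> * \<theta>) (sqrt s) y * h \<theta> y)
        \<partial>lborel \<partial>lborel)"
      using s h1 by (simp add: nn_integral_gauss nn_integral_cmult)
    also have "\<dots> = (\<integral>\<^sup>+ \<theta>. \<integral>\<^sup>+ y. normal_density 0 (sqrt w) y *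
        (normal_density (\<kappa> * l / w * y) (sqrt (l * s / w)) \<theta> * h \<theta> y) \<partial>lborel \<partial>lborel)"
    proof (intro nn_integral_cong)
      fix \<theta> y
      have "ennreal (normal_density 0 (sqrt l) \<theta>) * ennreal (normal_density (\<kappa> * \<theta>) (sqrt s) y)
          = ennreal (normal_density 0 (sqrt w) y)
            * ennreal (normal_density (\<kappa> * l / w * y) (sqrt (l * s / w)) \<theta>)"
        using normal_density_bayes[OF l s, of \<kappa> \<theta> y]
        by (simp add: ennreal_mult[symmetric] w_def mult.commute)
      then show "ennreal (normal_density 0 (sqrt l) \<theta>) * (normal_density (\<kappa> * \<theta>) (sqrt s) y * h \<theta> y)
        = normal_density 0 (sqrt w) y * (normal_density (\<kappa> * l / w * y) (sqrt (l * s / w)) \<theta> * h \<theta> y)"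
        by (simp add: mult.assoc[symmetric])
    qed
    also have "\<dots> = (\<integral>\<^sup>+ y. \<integral>\<^sup>+ \<theta>. normal_density 0 (sqrt w) y *
        (normal_density (\<kappa> * l / w * y) (sqrt (l * s / w)) \<theta> * h \<theta> y) \<partial>lborel \<partial>lborel)"
      unfolding normal_density_def
      by (rule lborel_pair.Fubini') measurable
    also have "\<dots> = (\<integral>\<^sup>+ y. normal_density 0 (sqrt w) y *
        (\<integral>\<^sup>+ \<theta>. h \<theta> y \<partial>gauss (\<kappa> * l / w * y) (l * s / w)) \<partial>lborel)"
      using v h1 by (simp add: nn_integral_gauss nn_integral_cmult)
    also have "\<dots> = (\<integral>\<^sup>+ y. \<integral>\<^sup>+ \<theta>. h \<theta> y \<partial>gauss (\<kappa> * l / w * y) (l * s / w) \<partial>gauss 0 w)"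
      by (rule nn_integral_gauss[OF m2 w, symmetric])
    finally show ?thesis .
  qed
qed

lemma gauss_marginal:
  fixes \<kappa> l s :: real and h :: "real \<Rightarrow> ennreal"
  assumes l: "l \<ge> 0" and s: "s > 0" and h: "h \<in> borel_measurable borel"
  shows "(\<integral>\<^sup>+ \<theta>. \<integral>\<^sup>+ y. h y \<partial>gauss (\<kappa> * \<theta>) s \<partial>gauss 0 l) = (\<integral>\<^sup>+ y. h y \<partial>gauss 0 (\<kappa>\<^sup>2 * l + s))"
proof -
  have "emeasure (gauss m v) UNIV = 1" for m v
    using prob_space.emeasure_space_1[OF prob_space_gauss[of m v]] by simp
  then show ?thesis
    using gauss_disintegration[OF l s, of "\<lambda>\<theta> y. h y" \<kappa>] h by (simp add: case_prod_unfold)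
qed

text \<open>
  Since \<open>q\<close> is the density of the data under \<open>f\<close> with respect to the marginal law, the left-hand side
  is the mean under \<open>f\<close> of the posterior mean square error. Exchanging the order of integration evaluates
  it as squared bias \<open>a\<^sup>2 f\<^sup>2\<close>, plus variance of the posterior mean, plus posterior variance \<open>l * a\<close>. The
  second of these is at most the third, which explains the factor 2.
\<close>

lemma gauss_posterior_risk:
  fixes \<kappa> l s f :: real
  assumes l: "l \<ge> 0" and s: "s > 0"
    and q: "q \<in> borel_measurable borel" and dens: "density (gauss 0 (\<kappa>\<^sup>2 * l + s)) q = gauss (\<kappa> * f) s"
  defines "a \<equiv> s / (\<kappa>\<^sup>2 * l + s)"
  shows "(\<integral>\<^sup>+ \<theta>. ennreal ((\<theta> - f)\<^sup>2) * (\<integral>\<^sup>+ y. q y \<partial>gauss (\<kappa> * \<theta>) s) \<partial>gauss 0 l)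
    \<le> ennreal (a\<^sup>2 * f\<^sup>2 + 2 * l * a)"
proof -
  let ?w = "\<kappa>\<^sup>2 * l + s" and ?c = "\<kappa> * l / (\<kappa>\<^sup>2 * l + s)"
  have w: "?w > 0" using assms by (auto intro: add_nonneg_pos)
  have v: "l * s / ?w \<ge> 0" using l s w by simp
  have "(\<integral>\<^sup>+ \<theta>. ennreal ((\<theta> - f)\<^sup>2) * (\<integral>\<^sup>+ y. q y \<partial>gauss (\<kappa> * \<theta>) s) \<partial>gauss 0 l)
      = (\<integral>\<^sup>+ \<theta>. \<integral>\<^sup>+ y. ennreal ((\<theta> - f)\<^sup>2) * q y \<partial>gauss (\<kappa> * \<theta>) s \<partial>gauss 0 l)"
    using q by (intro nn_integral_cong nn_integral_cmult[symmetric]) simp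
  also have "\<dots> = (\<integral>\<^sup>+ y. \<integral>\<^sup>+ \<theta>. ennreal ((\<theta> - f)\<^sup>2) * q y \<partial>gauss (?c * y) (l * s / ?w) \<partial>gauss 0 ?w)"
    using q by (intro gauss_disintegration l s) simp
  also have "\<dots> = (\<integral>\<^sup>+ y. q y * ennreal ((?c * y + - f)\<^sup>2 + l * s / ?w) \<partial>gauss 0 ?w)"
    using gauss_second_moment[OF v, where a=1 and b="- f"]
    by (intro nn_integral_cong) (simp add: nn_integral_cmult mult.commute)
  also have "\<dots> = (\<integral>\<^sup>+ y. ennreal ((?c * y + - f)\<^sup>2 + l * s / ?w) \<partial>gauss (\<kappa> * f) s)"
    unfolding dens[symmetric] using q by (subst nn_integral_density) auto
  also have "\<dots> = (\<integral>\<^sup>+ y. ennreal ((?c * y + - f)\<^sup>2) + ennreal (l * s / ?w) \<partial>gauss (\<kappa> * f) s)"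
    using v by (intro nn_integral_cong ennreal_plus) auto
  also have "\<dots> = (\<integral>\<^sup>+ y. ennreal ((?c * y + - f)\<^sup>2) \<partial>gauss (\<kappa> * f) s) + ennreal (l * s / ?w)"
    using prob_space.emeasure_space_1[OF prob_space_gauss[of "\<kappa> * f" s]]
    by (subst nn_integral_add) auto
  also have "\<dots> = ennreal ((?c * (\<kappa> * f) + - f)\<^sup>2 + ?c\<^sup>2 * s + l * s / ?w)"
    using v s l w by (subst gauss_second_moment) (auto simp: ennreal_plus[symmetric] simp del: ennreal_plus)
  also have "\<dots> \<le> ennreal (a\<^sup>2 * f\<^sup>2 + 2 * l * a)"
  proof (rule ennreal_leI)
    have "?c * (\<kappa> * f) + - f = - a * f"
      using w unfolding a_def by (simp add: field_simps power2_eq_square)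
    then have 1: "(?c * (\<kappa> * f) + - f)\<^sup>2 = a\<^sup>2 * f\<^sup>2" by (simp add: power_mult_distrib)
    have "?c\<^sup>2 * s = l * a * (\<kappa>\<^sup>2 * l / ?w)"
      using w unfolding a_def by (simp add: field_simps power2_eq_square)
    also have "\<dots> \<le> l * a * 1"
      using w l s by (intro mult_left_mono) (auto simp: a_def)
    finally have 2: "?c\<^sup>2 * s \<le> l * a" by simp
    have 3: "l * s / ?w = l * a" by (simp add: a_def)
    show "(?c * (\<kappa> * f) + - f)\<^sup>2 + ?c\<^sup>2 * s + l * s / ?w \<le> a\<^sup>2 * f\<^sup>2 + 2 * l * a"
      using 1 2 3 by linarith
  qed
  finally show ?thesis .
qed

section \<open>The sequence model with a truncated Gaussian prior\<close>

lemma distr_PiM_componentwise: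
  assumes "product_prob_space M" and f: "\<And>i. f i \<in> M i \<rightarrow>\<^sub>M N i"
  shows "distr (PiM I M) (PiM I N) (\<lambda>x. \<lambda>i\<in>I. f i (x i)) = PiM I (\<lambda>i. distr (M i) (N i) (f i))"
proof -
  interpret M: product_prob_space M I by fact
  let ?D = "\<lambda>i. distr (M i) (N i) (f i)"
  interpret D: product_prob_space ?D I
    by (intro product_prob_spaceI M.M.prob_space_distr f)
  have meas: "(\<lambda>x. \<lambda>i\<in>I. f i (x i)) \<in> PiM I M \<rightarrow>\<^sub>M PiM I N"
  proof (intro measurable_restrict)
    fix i assume "i \<in> I"
    then show "(\<lambda>x. f i (x i)) \<in> PiM I M \<rightarrow>\<^sub>M N i"
      using measurable_compose[OF measurable_component_singleton[of i I M] f[of i]] by simp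
  qed
  have sets_D: "sets (PiM I ?D) = sets (PiM I N)" by (intro sets_PiM_cong) auto
  show ?thesis
  proof (rule D.PiM_eq)
    show "sets (distr (PiM I M) (PiM I N) (\<lambda>x. \<lambda>i\<in>I. f i (x i))) = sets (PiM I ?D)"
      by (simp add: sets_D)
  next
    fix J F assume J: "finite J" "J \<subseteq> I" and F: "\<And>j. j \<in> J \<Longrightarrow> F j \<in> sets (?D j)"
    have emb: "prod_emb I ?D J (Pi\<^sub>E J F) \<in> sets (PiM I N)"
      unfolding sets_D[symmetric] using J F by (intro sets_PiM_I) auto
    have pre: "(\<lambda>x. \<lambda>i\<in>I. f i (x i)) -` prod_emb I ?D J (Pi\<^sub>E J F) \<inter> space (PiM I M)
        = prod_emb I M J (Pi\<^sub>E J (\<lambda>i. f i -` F i \<inter> space (M i)))"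
      using J f[THEN measurable_space]
      by (auto simp: prod_emb_iff space_PiM PiE_iff subset_eq extensional_def)
    have "emeasure (distr (PiM I M) (PiM I N) (\<lambda>x. \<lambda>i\<in>I. f i (x i))) (prod_emb I ?D J (Pi\<^sub>E J F))
        = emeasure (PiM I M) (prod_emb I M J (Pi\<^sub>E J (\<lambda>i. f i -` F i \<inter> space (M i))))"
      by (simp only: emeasure_distr[OF meas emb] pre)
    also have "\<dots> = (\<Prod>i\<in>J. emeasure (M i) (f i -` F i \<inter> space (M i)))"
      using J F f by (intro M.emeasure_PiM_emb) (auto intro: measurable_sets)
    also have "\<dots> = (\<Prod>i\<in>J. emeasure (?D i) (F i))"
      using F f by (intro prod.cong) (auto simp: emeasure_distr)
    finally show "emeasure (distr (PiM I M) (PiM I N) (\<lambda>x. \<lambda>i\<in>I. f i (x i)))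
        (prod_emb I ?D J (Pi\<^sub>E J F)) = (\<Prod>j\<in>J. emeasure (?D j) (F j))" .
  qed
qed

lemma obs_law_eq_PiM_gauss:
  "obs_law \<kappa> n f = (\<Pi>\<^sub>M i\<in>{1..}. gauss (\<kappa> i * f i) (1 / real n))"
proof -
  have "product_prob_space (\<lambda>i::nat. density lborel std_normal_density)"
    by (intro product_prob_spaceI prob_space_normal_density) simp
  from distr_PiM_componentwise[OF this, of "\<lambda>i z. \<kappa> i * f i + sqrt (1 / real n) * z" "\<lambda>_. borel"]
  show ?thesis unfolding obs_law_def gauss_def by (simp add: real_sqrt_divide)
qed

lemma measurable_obs_law: "obs_law \<kappa> n \<in> seq_space \<rightarrow>\<^sub>M subprob_algebra seq_space"
proof -
  let ?Z = "\<Pi>\<^sub>M i\<in>{1::nat..}. density lborel std_normal_density"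
  interpret prob_space ?Z by (intro prob_space_PiM prob_space_normal_density) simp
  have [measurable]: "(\<lambda>x. fst x i) \<in> borel_measurable (seq_space \<Otimes>\<^sub>M ?Z)" if "i \<ge> 1" for i
    using that by (intro measurable_compose[OF measurable_fst] measurable_component_singleton) auto
  have [measurable]: "(\<lambda>x. snd x i) \<in> borel_measurable (seq_space \<Otimes>\<^sub>M ?Z)" if "i \<ge> 1" for i
    using measurable_compose[OF measurable_snd measurable_component_singleton[of i "{1..}"]] that
    by (auto cong: measurable_cong_sets)
  have "obs_law \<kappa> n = (\<lambda>f. distr ?Z seq_space (\<lambda>Z. \<lambda>i\<in>{1..}. \<kappa> i * f i + Z i / sqrt (real n)))"
    by (simp add: obs_law_def fun_eq_iff)
  also have "\<dots> \<in> seq_space \<rightarrow>\<^sub>M subprob_algebra seq_space"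
  proof (rule measurable_distr2[where M="?Z"])
    show "case_prod (\<lambda>f Z. \<lambda>i\<in>{1..}. \<kappa> i * f i + Z i / sqrt (real n))
        \<in> seq_space \<Otimes>\<^sub>M ?Z \<rightarrow>\<^sub>M seq_space"
      unfolding case_prod_unfold by (intro measurable_restrict) auto
  qed (rule measurable_const, rule M_in_subprob)
  finally show ?thesis .
qed

lemma ell2_measurable [measurable]: "ell2 \<in> sets seq_space"
proof -
  have [measurable]: "(\<lambda>f. f (Suc i)) \<in> borel_measurable seq_space" for i
    by (rule measurable_component_singleton) simp
  have "summable (\<lambda>i. (f (Suc i))\<^sup>2) \<longleftrightarrow> (\<Sum>i. ennreal ((f (Suc i))\<^sup>2)) < \<infinity>" for f :: "nat \<Rightarrow> real"
    by (auto simp: less_top intro: summable_suminf_not_top dest: suminf_ennreal2[rotated])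
  then have "ell2 = {f \<in> space seq_space. (\<Sum>i. ennreal ((f (Suc i))\<^sup>2)) < \<infinity>}"
    by (auto simp: ell2_def space_PiM PiE_def)
  also have "\<dots> \<in> sets seq_space" by measurable
  finally show ?thesis .
qed

lemma sets_ell2_norm_ge:
  assumes "f0 \<in> ell2"
  shows "{f \<in> ell2. \<rho> \<le> ell2_norm (\<lambda>i. f i - f0 i)} \<in> sets seq_space"
proof -
  have [measurable]: "(\<lambda>f. f (Suc i)) \<in> borel_measurable seq_space" for i
    by (rule measurable_component_singleton) simp
  have [measurable]: "(\<lambda>f. ell2_norm (\<lambda>i. f i - f0 i)) \<in> borel_measurable seq_space"
    unfolding ell2_norm_def by measurable
  have "{f \<in> ell2. \<rho> \<le> ell2_norm (\<lambda>i. f i - f0 i)}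
      = ell2 \<inter> {f \<in> space seq_space. \<rho> \<le> ell2_norm (\<lambda>i. f i - f0 i)}"
    using sets.sets_into_space[OF ell2_measurable] by auto
  also have "\<dots> \<in> sets seq_space" by measurable
  finally show ?thesis .
qed

text \<open>
  The prior variances \<open>l\<close> vanish after the coordinate \<open>m\<close>, so that the prior is concentrated on sequences
  with finite support while all its coordinates are of the form \<open>gauss 0 (l i)\<close>.
\<close>

locale gaussian_sequence_model =
  fixes \<kappa> l :: "nat \<Rightarrow> real" and n m :: nat
  assumes n: "n > 0" and l: "l i \<ge> 0" and l_0: "i > m \<Longrightarrow> l i = 0"
begin

definition noise_var :: real where "noise_var = 1 / real n"

lemma noise_var: "noise_var > 0" using n by (simp add: noise_var_def)

lemma obs_law_eq: "obs_law \<kappa> n f = (\<Pi>\<^sub>M i\<in>{1..}. gauss (\<kappa> i * f i) noise_var)"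
  by (simp add: obs_law_eq_PiM_gauss noise_var_def)

definition prior :: "(nat \<Rightarrow> real) measure" where
  "prior = (\<Pi>\<^sub>M i\<in>{1..}. gauss 0 (l i))"

definition marg_var :: "nat \<Rightarrow> real" where "marg_var i = (\<kappa> i)\<^sup>2 * l i + noise_var"

lemma marg_var: "marg_var i > 0"
  using l[of i] noise_var by (auto simp: marg_var_def intro: add_nonneg_pos)

definition marginal :: "(nat \<Rightarrow> real) measure" where
  "marginal = (\<Pi>\<^sub>M i\<in>{1..}. gauss 0 (marg_var i))"

lemma sets_PiM_gauss: "sets (\<Pi>\<^sub>M i\<in>{1..}. gauss (a i) (b i)) = sets seq_space"
  by (intro sets_PiM_cong) auto

lemma sets_prior [simp, measurable_cong]: "sets prior = sets seq_space"
  and sets_marginal [simp, measurable_cong]: "sets marginal = sets seq_space"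
  and sets_obs_law [simp]: "sets (obs_law \<kappa> n f) = sets seq_space"
  by (simp_all only: prior_def marginal_def obs_law_eq sets_PiM_gauss)

lemma product_gauss: "product_prob_space (\<lambda>i::nat. gauss (a i) (b i))"
  by (intro product_prob_spaceI prob_space_gauss)

sublocale prior: product_prob_space "\<lambda>i. gauss 0 (l i)" "{1..}"
  by (rule product_gauss)
sublocale marg: product_prob_space "\<lambda>i. gauss 0 (marg_var i)" "{1..}"
  by (rule product_gauss)

lemma prob_space_obs_law: "prob_space (obs_law \<kappa> n f)"
  unfolding obs_law_eq by (intro prob_space_PiM prob_space_gauss)

lemma nn_integral_obs_law_prod:
  assumes "finite J" "J \<subseteq> {1..}" "\<And>i. q i \<in> borel_measurable borel"
  shows "(\<integral>\<^sup>+ y. (\<Prod>i\<in>J. q i (y i)) \<partial>obs_law \<kappa> n f) = (\<Prod>i\<in>J. \<integral>\<^sup>+ y. q i y \<partial>gauss (\<kappa> i * f i) noise_var)"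
  unfolding obs_law_eq using assms
  by (intro product_prob_space.nn_integral_PiM_finite_prod product_gauss) auto

lemma likelihood_measurable:
  "q \<in> borel_measurable borel \<Longrightarrow> (\<lambda>\<theta>. \<integral>\<^sup>+ y. q y \<partial>gauss (\<kappa> i * \<theta>) noise_var) \<in> borel_measurable borel"
  by (rule nn_integral_measurable_subprob_algebra2[where N=borel])
     (auto intro!: measurable_gauss_param)

text \<open>
  The weight, as a function of \<open>f\<close>, is a product over the coordinates. Each factor has prior mean one,
  so that only the factor at \<open>j\<close> interacts with \<open>g\<close>.
\<close>

lemma nn_integral_prior_weighted:
  assumes J: "finite J" "J \<subseteq> {1..}" and j: "j \<in> J"
    and q: "\<And>i. q i \<in> borel_measurable borel" "\<And>i. i \<in> J \<Longrightarrow> (\<integral>\<^sup>+ y. q i y \<partial>gauss 0 (marg_var i)) = 1"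
    and g: "g \<in> borel_measurable borel"
  shows "(\<integral>\<^sup>+ f. g (f j) * (\<integral>\<^sup>+ y. (\<Prod>i\<in>J. q i (y i)) \<partial>obs_law \<kappa> n f) \<partial>prior)
    = (\<integral>\<^sup>+ \<theta>. g \<theta> * (\<integral>\<^sup>+ y. q j y \<partial>gauss (\<kappa> j * \<theta>) noise_var) \<partial>gauss 0 (l j))"
proof -
  let ?L = "\<lambda>i \<theta>. \<integral>\<^sup>+ y. q i y \<partial>gauss (\<kappa> i * \<theta>) noise_var"
  let ?h = "\<lambda>i \<theta>. (if i = j then g \<theta> else 1) * ?L i \<theta>"
  have hm: "?h i \<in> borel_measurable borel" for i
    using g likelihood_measurable[OF q(1)] by (cases "i = j") auto
  have "(\<integral>\<^sup>+ f. g (f j) * (\<integral>\<^sup>+ y. (\<Prod>i\<in>J. q i (y i)) \<partial>obs_law \<kappa> n f) \<partial>prior)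
      = (\<integral>\<^sup>+ f. (\<Prod>i\<in>J. ?h i (f i)) \<partial>prior)"
    using J j q by (simp add: nn_integral_obs_law_prod prod.distrib prod.delta)
  also have "\<dots> = (\<Prod>i\<in>J. \<integral>\<^sup>+ \<theta>. ?h i \<theta> \<partial>gauss 0 (l i))"
    unfolding prior_def using J hm by (intro prior.nn_integral_PiM_finite_prod) auto
  also have "\<dots> = (\<Prod>i\<in>J. if i = j then \<integral>\<^sup>+ \<theta>. g \<theta> * ?L j \<theta> \<partial>gauss 0 (l j) else 1)"
    using q gauss_marginal[OF l noise_var] by (intro prod.cong) (auto simp: marg_var_def)
  also have "\<dots> = (\<integral>\<^sup>+ \<theta>. g \<theta> * ?L j \<theta> \<partial>gauss 0 (l j))"
    using J j by (simp add: prod.delta)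
  finally show ?thesis .
qed

lemma AE_prior_vanishes: "AE f in prior. \<forall>i. i > m \<longrightarrow> f i = 0"
proof -
  have "AE f in prior. i > m \<longrightarrow> f i = 0" for i
  proof (cases "i > m")
    case True
    have "AE t in return borel 0. t = (0::real)" by (subst AE_return) auto
    then have "AE t in gauss 0 (l i). t = 0" by (simp only: l_0[OF True] gauss_0)
    with True show ?thesis
      unfolding prior_def by (intro AE_PiM_component[where P="\<lambda>t. i > m \<longrightarrow> t = 0"] prob_space_gauss) auto
  qed simp
  then show ?thesis by (simp add: AE_all_countable)
qed

lemma AE_prior_ell2: "AE f in prior. f \<in> ell2"
proof -
  note AE_prior_vanishes
  moreover have "AE f in prior. f \<in> space seq_space"
    by (rule AE_I2) (use sets_eq_imp_space_eq[OF sets_prior] in auto)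
  ultimately show ?thesis
  proof eventually_elim
    case (elim f)
    have "summable (\<lambda>i. (f (Suc i))\<^sup>2)"
      by (rule summable_finite[of "{..<m}"]) (use elim in auto)
    with elim show ?case by (auto simp: ell2_def space_PiM PiE_def)
  qed
qed

lemma ell2_in_sets_prior: "ell2 \<inter> space prior \<in> sets prior"
  using sets.Int[OF ell2_measurable sets.top[of seq_space]]
  by (simp only: sets_prior sets_eq_imp_space_eq[OF sets_prior])

lemma nn_integral_restricted_prior:
  assumes "g \<in> borel_measurable seq_space"
  shows "(\<integral>\<^sup>+ f. g f \<partial>restrict_space prior ell2) = (\<integral>\<^sup>+ f. g f \<partial>prior)"
proof -
  have "(\<integral>\<^sup>+ f. g f \<partial>restrict_space prior ell2) = (\<integral>\<^sup>+ f. g f * indicator ell2 f \<partial>prior)"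
    by (rule nn_integral_restrict_space[OF ell2_in_sets_prior])
  also have "\<dots> = (\<integral>\<^sup>+ f. g f \<partial>prior)"
    using AE_prior_ell2 by (intro nn_integral_cong_AE) (auto elim!: eventually_mono)
  finally show ?thesis .
qed

lemma space_restricted_prior: "space (restrict_space prior ell2) \<noteq> {}"
proof -
  have "(\<lambda>i\<in>{1..}. 0 :: real) \<in> ell2 \<inter> space prior"
    unfolding sets_eq_imp_space_eq[OF sets_prior] by (auto simp: ell2_def space_PiM)
  then show ?thesis by (auto simp: space_restrict_space)
qed

lemma measurable_obs_law_restricted:
  "obs_law \<kappa> n \<in> restrict_space prior ell2 \<rightarrow>\<^sub>M subprob_algebra seq_space"
  by (intro measurable_restrict_space1)
     (simp only: measurable_obs_law measurable_cong_sets[OF sets_prior refl])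

lemma restricted_prior_bind_obs_law: "restrict_space prior ell2 \<bind> obs_law \<kappa> n = marginal"
  unfolding marginal_def
proof (rule marg.PiM_eq)
  let ?P = "restrict_space prior ell2"
  have sets_marg: "sets (\<Pi>\<^sub>M i\<in>{1..}. gauss 0 (marg_var i)) = sets seq_space"
    by (rule sets_PiM_gauss)
  show "sets (?P \<bind> obs_law \<kappa> n) = sets (\<Pi>\<^sub>M i\<in>{1..}. gauss 0 (marg_var i))"
    unfolding sets_marg by (intro sets_bind space_restricted_prior sets_obs_law)
  fix J F assume J: "finite J" "J \<subseteq> {1::nat..}" and F: "\<And>j. j \<in> J \<Longrightarrow> F j \<in> sets (gauss 0 (marg_var j))"
  let ?q = "\<lambda>i y. if i \<in> J then indicator (F i) y else 1 :: ennreal"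
  let ?X = "prod_emb {1..} (\<lambda>i. gauss 0 (marg_var i)) J (Pi\<^sub>E J F)"
  have qm: "?q i \<in> borel_measurable borel" for i using F[of i] by (cases "i \<in> J") auto
  have Xs: "?X \<in> sets seq_space"
    unfolding sets_marg[symmetric] using J F by (intro sets_PiM_I) auto
  have em: "emeasure (obs_law \<kappa> n f) ?X = (\<Prod>i\<in>J. \<integral>\<^sup>+ y. ?q i y \<partial>gauss (\<kappa> i * f i) noise_var)" for f
  proof -
    have "emeasure (obs_law \<kappa> n f) ?X = (\<integral>\<^sup>+ y. indicator ?X y \<partial>obs_law \<kappa> n f)"
      using Xs by (intro nn_integral_indicator[symmetric]) simp
    also have "\<dots> = (\<integral>\<^sup>+ y. (\<Prod>i\<in>J. ?q i (y i)) \<partial>obs_law \<kappa> n f)"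
    proof (intro nn_integral_cong)
      fix y assume "y \<in> space (obs_law \<kappa> n f)"
      then have "y \<in> space (\<Pi>\<^sub>M i\<in>{1..}. gauss 0 (marg_var i))"
        using sets_eq_imp_space_eq[OF sets_obs_law] sets_eq_imp_space_eq[OF sets_marg] by blast
      then show "indicator ?X y = (\<Prod>i\<in>J. ?q i (y i))"
        using J by (subst indicator_prod_emb) auto
    qed
    also have "\<dots> = (\<Prod>i\<in>J. \<integral>\<^sup>+ y. ?q i y \<partial>gauss (\<kappa> i * f i) noise_var)"
      using J qm by (intro nn_integral_obs_law_prod) auto
    finally show ?thesis .
  qed
  have "emeasure (?P \<bind> obs_law \<kappa> n) ?X = (\<integral>\<^sup>+ f. emeasure (obs_law \<kappa> n f) ?X \<partial>?P)"
    by (rule emeasure_bind[OF space_restricted_prior measurable_obs_law_restricted Xs])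
  also have "\<dots> = (\<integral>\<^sup>+ f. emeasure (obs_law \<kappa> n f) ?X \<partial>prior)"
    using measurable_compose[OF measurable_obs_law measurable_emeasure_subprob_algebra[OF Xs]]
    by (rule nn_integral_restricted_prior)
  also have "\<dots> = (\<integral>\<^sup>+ f. (\<Prod>i\<in>J. \<integral>\<^sup>+ y. ?q i y \<partial>gauss (\<kappa> i * f i) noise_var) \<partial>prior)"
    unfolding em ..
  also have "\<dots> = (\<Prod>i\<in>J. \<integral>\<^sup>+ \<theta>. \<integral>\<^sup>+ y. ?q i y \<partial>gauss (\<kappa> i * \<theta>) noise_var \<partial>gauss 0 (l i))"
    unfolding prior_def
  proof (rule prior.nn_integral_PiM_finite_prod[OF J,
        where g="\<lambda>i \<theta>. \<integral>\<^sup>+ y. ?q i y \<partial>gauss (\<kappa> i * \<theta>) noise_var"])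
    show "(\<lambda>\<theta>. \<integral>\<^sup>+ y. ?q i y \<partial>gauss (\<kappa> i * \<theta>) noise_var) \<in> borel_measurable (gauss 0 (l i))" for i
      unfolding measurable_cong_sets[OF sets_gauss refl] by (rule likelihood_measurable[OF qm])
  qed
  also have "\<dots> = (\<Prod>i\<in>J. \<integral>\<^sup>+ y. ?q i y \<partial>gauss 0 (marg_var i))"
    unfolding marg_var_def by (intro prod.cong refl gauss_marginal[OF l noise_var qm])
  also have "\<dots> = (\<Prod>i\<in>J. emeasure (gauss 0 (marg_var i)) (F i))"
    using F by (intro prod.cong) auto
  finally show "emeasure (?P \<bind> obs_law \<kappa> n) ?X = (\<Prod>i\<in>J. emeasure (gauss 0 (marg_var i)) (F i))" .
qed

text \<open>
  The law of the data for a parameter that vanishes after \<open>N \<ge> m\<close> differs from the marginal law in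
  the first \<open>N\<close> coordinates only, and therefore has a density that is a finite product.
\<close>

definition head :: "nat \<Rightarrow> (nat \<Rightarrow> real) \<Rightarrow> nat \<Rightarrow> real" where
  "head N f i = (if i \<le> N then f i else 0)"

text \<open>
  The density, in the coordinate \<open>i\<close>, of the data under \<open>f\<close> with respect to the marginal law.
\<close>

definition ratio :: "(nat \<Rightarrow> real) \<Rightarrow> nat \<Rightarrow> real \<Rightarrow> ennreal" where
  "ratio f i y = ennreal (normal_density (\<kappa> i * f i) (sqrt noise_var) y / normal_density 0 (sqrt (marg_var i)) y)"

lemma ratio_measurable: "ratio f i \<in> borel_measurable borel"
  unfolding ratio_def by measurable

lemma density_ratio: "density (gauss 0 (marg_var i)) (ratio f i) = gauss (\<kappa> i * f i) noise_var"
  unfolding ratio_def by (rule gauss_density_ratio[OF noise_var marg_var, symmetric])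

lemma nn_integral_ratio: "(\<integral>\<^sup>+ y. ratio f i y \<partial>gauss 0 (marg_var i)) = 1"
proof -
  have "(\<integral>\<^sup>+ y. ratio f i y \<partial>gauss 0 (marg_var i)) = emeasure (density (gauss 0 (marg_var i)) (ratio f i)) UNIV"
    using ratio_measurable[of f i] by (subst emeasure_density) auto
  then show ?thesis
    using prob_space.emeasure_space_1[OF prob_space_gauss[of "\<kappa> i * f i" noise_var]] by (simp add: density_ratio)
qed

lemma density_marginal:
  assumes "N \<ge> m"
  shows "density marginal (\<lambda>y. \<Prod>i\<in>{1..N}. ratio f i (y i)) = obs_law \<kappa> n (head N f)"
proof -
  have "density marginal (\<lambda>y. \<Prod>i\<in>{1..N}. ratio f i (y i))
    = (\<Pi>\<^sub>M i\<in>{1..}. if i \<in> {1..N} then density (gauss 0 (marg_var i)) (ratio f i) else gauss 0 (marg_var i))"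
    unfolding marginal_def using ratio_measurable
    by (intro marg.density_PiM_finite_prod) (auto simp: density_ratio prob_space_gauss)
  also have "\<dots> = obs_law \<kappa> n (head N f)"
    unfolding obs_law_eq
  proof (intro PiM_cong refl)
    fix i assume "i \<in> {1::nat..}"
    moreover have "marg_var i = noise_var" if "i > N" using that assms by (simp add: marg_var_def l_0)
    ultimately show "(if i \<in> {1..N} then density (gauss 0 (marg_var i)) (ratio f i) else gauss 0 (marg_var i))
        = gauss (\<kappa> i * head N f i) noise_var"
      by (auto simp: density_ratio head_def)
  qed
  finally show ?thesis .
qed

text \<open>
  The relative weight of the noise in the variance of an observation. The posterior mean is
  \<open>1 - shrink i\<close> times the naive estimate \<open>y i / \<kappa> i\<close>, and the posterior variance is \<open>l i * shrink i\<close>.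
\<close>

definition shrink :: "nat \<Rightarrow> real" where "shrink i = noise_var / marg_var i"

text \<open>
  Bayes' identity turns the mean posterior mass of \<open>A\<close> into a prior integral over \<open>A\<close> of the averaged
  likelihood ratio. As in Markov's inequality, the indicator of \<open>A\<close> is bounded by the quadratic loss
  divided by \<open>c\<close>, and the sum over the coordinates separates into one-dimensional risks.
\<close>

lemma posterior_mass_head:
  assumes post: "is_posterior (restrict_space prior ell2) seq_space (obs_law \<kappa> n) K"
    and A: "A \<in> sets (restrict_space prior ell2)" and c: "c > 0"
    and loss: "AE f in prior. f \<in> A \<longrightarrow> c \<le> (\<Sum>i=1..m. (f i - f0 i)\<^sup>2)" and N: "N \<ge> m"
  shows "(\<integral>\<^sup>+ y. emeasure (K y) A \<partial>obs_law \<kappa> n (head N f0))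
    \<le> ennreal ((\<Sum>i=1..m. (shrink i)\<^sup>2 * (f0 i)\<^sup>2 + 2 * l i * shrink i) / c)"
proof -
  let ?P = "restrict_space prior ell2"
  let ?q = "\<lambda>y. \<Prod>i\<in>{1..N}. ratio f0 i (y i)"
  define W where "W f = (\<integral>\<^sup>+ y. ?q y \<partial>obs_law \<kappa> n f)" for f
  have qm: "?q \<in> borel_measurable seq_space"
  proof (intro borel_measurable_prod_ennreal)
    fix i assume "i \<in> {1..N}"
    then have "i \<in> {1..}" by auto
    then show "(\<lambda>y. ratio f0 i (y i)) \<in> borel_measurable seq_space"
      by (rule measurable_compose[OF measurable_component_singleton[of i "{1..}" "\<lambda>_. borel"]
            ratio_measurable[of f0 i]])
  qed
  have Wm: "W \<in> borel_measurable seq_space"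
    unfolding W_def using measurable_compose[OF measurable_obs_law nn_integral_measurable_subprob_algebra[OF qm]] .
  have K: "K \<in> seq_space \<rightarrow>\<^sub>M subprob_algebra ?P"
    using post by (auto simp: is_posterior_def intro: measurable_prob_algebraD)
  have KA: "(\<lambda>y. emeasure (K y) A) \<in> borel_measurable seq_space"
    using measurable_compose[OF K measurable_emeasure_subprob_algebra[OF A]] .
  have A': "A \<in> sets prior"
    using A sets_restrict_space_iff[OF ell2_in_sets_prior] by auto
  have fm: "(\<lambda>f. ennreal ((f i - f0 i)\<^sup>2)) \<in> borel_measurable prior" if "i \<in> {1..m}" for i
  proof -
    have "i \<in> {1..}" using that by auto
    then have "(\<lambda>f. f i) \<in> borel_measurable prior"
      unfolding measurable_cong_sets[OF sets_prior refl] by (rule measurable_component_singleton)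
    then show ?thesis by measurable
  qed
  have Wm': "W \<in> borel_measurable prior"
    using Wm unfolding measurable_cong_sets[OF sets_prior refl] .
  have "(\<integral>\<^sup>+ y. emeasure (K y) A \<partial>obs_law \<kappa> n (head N f0))
      = (\<integral>\<^sup>+ y. ?q y * emeasure (K y) A \<partial>(?P \<bind> obs_law \<kappa> n))"
    unfolding density_marginal[OF N, symmetric] restricted_prior_bind_obs_law
    using qm KA by (subst nn_integral_density) (simp_all only: measurable_cong_sets[OF sets_marginal refl])
  also have "\<dots> = (\<integral>\<^sup>+ f. indicator A f * W f \<partial>?P)"
    unfolding W_def by (rule is_posterior_nn_integral[OF post measurable_obs_law_restricted space_restricted_prior A qm])
  also have "\<dots> = (\<integral>\<^sup>+ f. indicator A f * W f \<partial>prior)"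
  proof (rule nn_integral_restricted_prior)
    show "(\<lambda>f. indicator A f * W f) \<in> borel_measurable seq_space"
      using A' Wm unfolding sets_prior by (intro borel_measurable_times_ennreal borel_measurable_indicator)
  qed
  also have "\<dots> \<le> (\<integral>\<^sup>+ f. (\<Sum>i=1..m. ennreal (1 / c) * (ennreal ((f i - f0 i)\<^sup>2) * W f)) \<partial>prior)"
  proof (intro nn_integral_mono_AE, use loss in eventually_elim)
    fix f assume f: "f \<in> A \<longrightarrow> c \<le> (\<Sum>i=1..m. (f i - f0 i)\<^sup>2)"
    have "(\<Sum>i=1..m. ennreal (1 / c) * (ennreal ((f i - f0 i)\<^sup>2) * W f))
        = ennreal (1 / c) * ennreal (\<Sum>i=1..m. (f i - f0 i)\<^sup>2) * W f"
      by (simp only: sum_distrib_left[symmetric] sum_distrib_right[symmetric] sum_ennreal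
          zero_le_power2 mult.assoc)
    moreover have "indicator A f \<le> ennreal (1 / c) * ennreal (\<Sum>i=1..m. (f i - f0 i)\<^sup>2)"
    proof (cases "f \<in> A")
      case True
      with f c have "1 \<le> 1 / c * (\<Sum>i=1..m. (f i - f0 i)\<^sup>2)" by (simp add: field_simps)
      then show ?thesis using True c by (simp add: ennreal_mult[symmetric] sum_nonneg del: times_divide_eq_left)
    qed simp
    ultimately show "indicator A f * W f
        \<le> (\<Sum>i=1..m. ennreal (1 / c) * (ennreal ((f i - f0 i)\<^sup>2) * W f))"
      by (auto intro: mult_right_mono)
  qed
  also have "\<dots> = (\<Sum>i=1..m. ennreal (1 / c) * (\<integral>\<^sup>+ f. ennreal ((f i - f0 i)\<^sup>2) * W f \<partial>prior))"
    using fm Wm' by (subst nn_integral_sum)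
      (auto intro!: sum.cong nn_integral_cmult borel_measurable_times_ennreal)
  also have "\<dots> \<le> (\<Sum>i=1..m. ennreal (1 / c) * ennreal ((shrink i)\<^sup>2 * (f0 i)\<^sup>2 + 2 * l i * shrink i))"
  proof (intro sum_mono mult_left_mono)
    fix i assume i: "i \<in> {1..m}"
    have "(\<integral>\<^sup>+ f. ennreal ((f i - f0 i)\<^sup>2) * W f \<partial>prior)
        = (\<integral>\<^sup>+ \<theta>. ennreal ((\<theta> - f0 i)\<^sup>2) * (\<integral>\<^sup>+ y. ratio f0 i y \<partial>gauss (\<kappa> i * \<theta>) noise_var) \<partial>gauss 0 (l i))"
      unfolding W_def using i N ratio_measurable nn_integral_ratio
      by (intro nn_integral_prior_weighted[where g="\<lambda>\<theta>. ennreal ((\<theta> - f0 i)\<^sup>2)"]) auto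
    also have "\<dots> \<le> ennreal ((shrink i)\<^sup>2 * (f0 i)\<^sup>2 + 2 * l i * shrink i)"
      unfolding shrink_def marg_var_def using density_ratio[of i f0] ratio_measurable[of f0 i]
      by (intro gauss_posterior_risk l noise_var) (auto simp: marg_var_def)
    finally show "(\<integral>\<^sup>+ f. ennreal ((f i - f0 i)\<^sup>2) * W f \<partial>prior)
        \<le> ennreal ((shrink i)\<^sup>2 * (f0 i)\<^sup>2 + 2 * l i * shrink i)" .
  qed simp
  also have "\<dots> = ennreal ((\<Sum>i=1..m. (shrink i)\<^sup>2 * (f0 i)\<^sup>2 + 2 * l i * shrink i) / c)"
  proof -
    have "(shrink i)\<^sup>2 * (f0 i)\<^sup>2 + 2 * l i * shrink i \<ge> 0" for i
      using l[of i] noise_var marg_var[of i] by (auto simp: shrink_def intro!: add_nonneg_nonneg mult_nonneg_nonneg)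
    then show ?thesis using c
      by (simp add: ennreal_mult[symmetric] sum_distrib_left[symmetric] sum_ennreal sum_nonneg
          sum_divide_distrib)
  qed
  finally show ?thesis .
qed

text \<open>
  The two laws differ by a shift in the coordinates after \<open>N\<close>. The chi-square integrals multiply to the
  exponential of the squared norm of the shift divided by the noise variance; for large \<open>N\<close> the quotient is
  below one, which gives the constant \<open>3 \<ge> exp 1\<close>.
\<close>

lemma ex_head_square_le:
  assumes f0: "summable (\<lambda>i. (\<kappa> (Suc i) * f0 (Suc i))\<^sup>2)"
  shows "\<exists>N\<ge>m. \<forall>A\<in>sets seq_space.
    (measure (obs_law \<kappa> n f0) A)\<^sup>2 \<le> 3 * measure (obs_law \<kappa> n (head N f0)) A"
proof -
  let ?g = "\<lambda>i. (\<kappa> (Suc i) * f0 (Suc i))\<^sup>2"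
  have "(\<lambda>N. \<Sum>i. ?g (i + N)) \<longlonglongrightarrow> 0" by (rule suminf_exist_split2[OF f0])
  then have "\<forall>\<^sub>F N in sequentially. (\<Sum>i. ?g (i + N)) < noise_var" using noise_var by (rule order_tendstoD)
  then have "\<forall>\<^sub>F N in sequentially. N \<ge> m \<and> (\<Sum>i. ?g (i + N)) < noise_var"
    using eventually_ge_at_top[of m] by eventually_elim simp
  then obtain N where N: "N \<ge> m" "(\<Sum>i. ?g (i + N)) < noise_var"
    by (auto simp: eventually_sequentially)
  have tail: "(\<Sum>i\<in>J. (\<kappa> i * f0 i)\<^sup>2) \<le> noise_var" if J: "finite J" "J \<subseteq> {N<..}" for J
  proof -
    have "(\<Sum>i\<in>J. (\<kappa> i * f0 i)\<^sup>2) = (\<Sum>i\<in>(\<lambda>j. j - Suc N) ` J. ?g (i + N))"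
      by (rule sum.reindex_bij_witness[where i="\<lambda>i. i + Suc N" and j="\<lambda>j. j - Suc N"])
        (use J in \<open>auto simp: subset_eq\<close>)
    also have "\<dots> \<le> (\<Sum>i. ?g (i + N))"
      using J summable_ignore_initial_segment[OF f0, of N] by (intro sum_le_suminf) auto
    finally show ?thesis using N(2) by linarith
  qed
  let ?T = "\<lambda>i. gauss (\<kappa> i * head N f0 i) noise_var"
  let ?r = "\<lambda>i y. if i \<le> N then 1 else
    ennreal (normal_density (\<kappa> i * f0 i) (sqrt noise_var) y / normal_density 0 (sqrt noise_var) y)"
  have dens: "density (?T i) (?r i) = gauss (\<kappa> i * f0 i) noise_var" for i
    using gauss_density_ratio[OF noise_var noise_var, of "\<kappa> i * f0 i" 0]
    by (cases "i \<le> N") (simp_all add: head_def density_1)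
  have chi: "(\<Prod>i\<in>J. \<integral>\<^sup>+ t. (?r i t)\<^sup>2 \<partial>?T i) \<le> ennreal 3" if J: "finite J" for J
  proof -
    have "(\<Prod>i\<in>J. \<integral>\<^sup>+ t. (?r i t)\<^sup>2 \<partial>?T i)
        = (\<Prod>i\<in>J. ennreal (exp (if i \<le> N then 0 else (\<kappa> i * f0 i)\<^sup>2 / noise_var)))"
      using prob_space.emeasure_space_1[OF prob_space_gauss] gauss_shift_chi_square[OF noise_var]
      by (intro prod.cong) (auto simp: head_def)
    also have "\<dots> = ennreal (exp (\<Sum>i\<in>J. if i \<le> N then 0 else (\<kappa> i * f0 i)\<^sup>2 / noise_var))"
      using J by (simp add: prod_ennreal exp_sum)
    also have "(\<Sum>i\<in>J. if i \<le> N then 0 else (\<kappa> i * f0 i)\<^sup>2 / noise_var)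
        = (\<Sum>i\<in>J \<inter> {N<..}. (\<kappa> i * f0 i)\<^sup>2) / noise_var"
      unfolding sum_divide_distrib using J by (intro sum.mono_neutral_cong_right) auto
    also have "ennreal (exp \<dots>) \<le> ennreal 3"
    proof (intro ennreal_leI order_trans[OF _ exp_le])
      have "(\<Sum>i\<in>J \<inter> {N<..}. (\<kappa> i * f0 i)\<^sup>2) \<le> noise_var" using J by (intro tail) auto
      then show "exp ((\<Sum>i\<in>J \<inter> {N<..}. (\<kappa> i * f0 i)\<^sup>2) / noise_var) \<le> exp 1" using noise_var by simp
    qed
    finally show ?thesis .
  qed
  have "(measure (obs_law \<kappa> n f0) A)\<^sup>2 \<le> 3 * measure (obs_law \<kappa> n (head N f0)) A"
    if A: "A \<in> sets seq_space" for A
  proof -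
    have "(measure (\<Pi>\<^sub>M i\<in>{1..}. density (?T i) (?r i)) A)\<^sup>2 \<le> 3 * measure (PiM {1..} ?T) A"
    proof (rule PiM_density_square_le[OF product_gauss _ _ chi])
      show "?r i \<in> borel_measurable (?T i)" for i by (cases "i \<le> N") auto
      show "prob_space (density (?T i) (?r i))" for i unfolding dens by (rule prob_space_gauss)
      show "A \<in> sets (PiM {1..} ?T)" unfolding sets_PiM_gauss by (rule A)
    qed simp_all
    then show ?thesis unfolding dens obs_law_eq .
  qed
  with N(1) show ?thesis by blast
qed

text \<open>
  The cut-off \<open>N\<close> depends on \<open>f0\<close> and on the noise variance, but it does not appear in the bound. This is why
  the bound is uniform over the smoothness class in the end.
\<close>

lemma posterior_mass:
  assumes post: "is_posterior (restrict_space prior ell2) seq_space (obs_law \<kappa> n) K"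
    and A: "A \<in> sets (restrict_space prior ell2)" and c: "c > 0" and t: "t > 0"
    and loss: "AE f in prior. f \<in> A \<longrightarrow> c \<le> (\<Sum>i=1..m. (f i - f0 i)\<^sup>2)"
    and f0: "summable (\<lambda>i. (\<kappa> (Suc i) * f0 (Suc i))\<^sup>2)"
    and \<delta>: "(\<Sum>i=1..m. (shrink i)\<^sup>2 * (f0 i)\<^sup>2 + 2 * l i * shrink i) / c \<le> \<delta>"
  shows "(\<integral>\<^sup>+ y. emeasure (K y) A \<partial>obs_law \<kappa> n f0) \<le> ennreal (t + sqrt (3 * (\<delta> / t)))"
proof -
  obtain N where N: "N \<ge> m" and sq: "\<And>A. A \<in> sets seq_space \<Longrightarrow>
      (measure (obs_law \<kappa> n f0) A)\<^sup>2 \<le> 3 * measure (obs_law \<kappa> n (head N f0)) A"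
    using ex_head_square_le[OF f0] by blast
  have "(shrink i)\<^sup>2 * (f0 i)\<^sup>2 + 2 * l i * shrink i \<ge> 0" for i
    using l[of i] noise_var marg_var[of i] by (auto simp: shrink_def intro!: add_nonneg_nonneg mult_nonneg_nonneg)
  then have \<delta>0: "\<delta> \<ge> 0" using \<delta> c by (meson divide_nonneg_pos order_trans sum_nonneg)
  have K: "K \<in> seq_space \<rightarrow>\<^sub>M prob_algebra (restrict_space prior ell2)"
    using post by (simp add: is_posterior_def)
  have KA: "(\<lambda>y. emeasure (K y) A) \<in> borel_measurable seq_space"
    using measurable_compose[OF measurable_prob_algebraD[OF K] measurable_emeasure_subprob_algebra[OF A]] .
  \<comment> \<open>Outside the observation space \<open>K y\<close> need not be a probability measure.\<close>
  let ?\<phi> = "\<lambda>y. min 1 (emeasure (K y) A)"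
  have "(\<integral>\<^sup>+ y. emeasure (K y) A \<partial>obs_law \<kappa> n f0) = (\<integral>\<^sup>+ y. ?\<phi> y \<partial>obs_law \<kappa> n f0)"
  proof (intro nn_integral_cong)
    fix y assume "y \<in> space (obs_law \<kappa> n f0)"
    then have "y \<in> space seq_space" using sets_eq_imp_space_eq[OF sets_obs_law] by blast
    then have "prob_space (K y)" using measurable_space[OF K] by (auto simp: space_prob_algebra)
    then show "emeasure (K y) A = ?\<phi> y" by (simp add: prob_space.measure_le_1 min_absorb2)
  qed
  also have "\<dots> \<le> ennreal (t + sqrt (3 * (\<delta> / t)))"
  proof (rule nn_integral_le_of_square_le[OF prob_space_obs_law prob_space_obs_law _ _ _ _ _ _ \<delta>0 t])
    show "?\<phi> \<in> borel_measurable (obs_law \<kappa> n (head N f0))"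
      using KA unfolding measurable_cong_sets[OF sets_obs_law refl] by measurable
    show "(\<integral>\<^sup>+ y. ?\<phi> y \<partial>obs_law \<kappa> n (head N f0)) \<le> ennreal \<delta>"
      by (rule order_trans[OF nn_integral_mono order_trans[OF
            posterior_mass_head[OF post A c loss N] ennreal_leI[OF \<delta>]]]) simp
    show "sets (obs_law \<kappa> n f0) = sets (obs_law \<kappa> n (head N f0))"
      unfolding sets_obs_law ..
    show "(measure (obs_law \<kappa> n f0) A)\<^sup>2 \<le> 3 * measure (obs_law \<kappa> n (head N f0)) A"
      if "A \<in> sets (obs_law \<kappa> n (head N f0))" for A
      using sq that unfolding sets_obs_law by blast
  qed auto
  finally show ?thesis .
qed

end

section \<open>Bias, variance and the truncation point\<close>

text \<open>
  This is \<open>ln z \<le> z\<close> at \<open>z = e * u / b\<close>, multiplied by \<open>b\<close> and exponentiated.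
\<close>

lemma powr_le_exp:
  fixes u b e :: real
  assumes "u > 0" "b > 0" "e > 0"
  shows "u powr b \<le> (b / e) powr b * exp (e * u)"
proof -
  have "ln (e * u / b) \<le> e * u / b" using assms by (intro ln_bound) auto
  also have "ln (e * u / b) = ln u - ln (b / e)" using assms by (simp add: ln_div ln_mult)
  finally have "b * ln u \<le> b * ln (b / e) + e * u" using assms by (simp add: field_simps)
  then have "exp (b * ln u) \<le> exp (b * ln (b / e) + e * u)" by simp
  then show ?thesis using assms by (simp add: powr_def exp_add)
qed

text \<open>
  Here \<open>p \<ge> 1\<close> enters: with \<open>u = k / x \<ge> 1\<close>, the right-hand side is \<open>x\<^sup>p (u\<^sup>p - 1)\<close>.
\<close>

lemma powr_diff_ge:
  fixes x k p :: real
  assumes "p \<ge> 1" "1 \<le> x" "x \<le> k"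
  shows "k / x - 1 \<le> k powr p - x powr p"
proof -
  have u: "1 \<le> k / x" using assms by simp
  have "1 * (k / x - 1) \<le> x powr p * ((k / x) powr p - 1)"
  proof (intro mult_mono)
    show "1 \<le> x powr p" using assms by (intro ge_one_powr_ge_zero) auto
    have "(k / x) powr 1 \<le> (k / x) powr p" using u assms by (intro powr_mono) auto
    then show "k / x - 1 \<le> (k / x) powr p - 1" using u assms by simp
  qed (use u in auto)
  also have "\<dots> = k powr p - x powr p" using assms by (simp add: powr_divide algebra_simps)
  finally show ?thesis by simp
qed

lemma truncation_point_ge_1:
  fixes N k p \<alpha> \<eta> :: real
  assumes "p \<ge> 0" "\<alpha> \<ge> 0" "\<eta> > 0" "k > 0" and N: "N = k powr \<alpha> * exp (\<eta> * k powr p)"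
    and "N > exp \<eta>"
  shows "k \<ge> 1"
proof (rule ccontr)
  assume "\<not> k \<ge> 1"
  then have "k powr \<alpha> \<le> 1" "k powr p \<le> 1" using assms by (auto intro: powr_le1)
  then have "k powr \<alpha> * exp (\<eta> * k powr p) \<le> 1 * exp (\<eta> * 1)"
    using assms by (intro mult_mono) auto
  with assms show False by simp
qed

text \<open>
  Taking logarithms, \<open>ln N = \<alpha> * ln k + \<eta> * k powr p \<le> (\<alpha> + \<eta>) * k powr p\<close>. Thus a rate in terms of
  \<open>k\<close> is a rate in terms of \<open>ln N\<close>.
\<close>

lemma truncation_point_rate:
  fixes N k p \<alpha> \<eta> b :: real
  assumes "p \<ge> 1" "\<alpha> \<ge> 0" "\<eta> > 0" "k \<ge> 1" and N: "N = k powr \<alpha> * exp (\<eta> * k powr p)" and "b > 0"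
  shows "(\<alpha> + \<eta>) powr (- b / p) * k powr (- b) \<le> ln N powr (- b / p)"
proof -
  have "ln k \<le> k powr p"
    using assms ln_bound[of k] powr_mono[of 1 p k] by simp
  have "k powr p > 0" using assms by simp
  have "ln N = \<alpha> * ln k + \<eta> * k powr p" using assms by (simp add: ln_mult ln_powr)
  then have upper: "ln N \<le> (\<alpha> + \<eta>) * k powr p"
    using \<open>ln k \<le> k powr p\<close> assms by (simp add: algebra_simps mult_left_mono)
  have "0 \<le> \<alpha> * ln k" "0 < \<eta> * k powr p" using assms \<open>k powr p > 0\<close> by auto
  then have pos: "ln N > 0" using \<open>ln N = \<alpha> * ln k + \<eta> * k powr p\<close> by linarith
  have "(\<alpha> + \<eta>) powr (- b / p) * k powr (- b) = ((\<alpha> + \<eta>) * k powr p) powr (- b / p)"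
    using assms by (simp add: powr_mult powr_powr)
  also have "\<dots> \<le> ln N powr (- b / p)"
    using upper pos assms by (intro powr_mono2') auto
  finally show ?thesis .
qed

text \<open>
  The signal-to-noise ratio \<open>N \<kappa>\<^sup>2 l\<close> at \<open>x\<close> is at least
  \<open>c\<^sup>2 (k / x)\<^sup>\<alpha> exp (\<eta> (k\<^sup>p - x\<^sup>p))\<close>, by the equation for \<open>k\<close>. It is exponentially large
  in \<open>k / x\<close>, and so the shrinkage, at most its inverse, is below a multiple of any power of \<open>x / k\<close>. The
  variance term is at most \<open>2 / (N \<kappa>\<^sup>2)\<close>, hence at most a multiple of \<open>exp (2 \<gamma> x\<^sup>p) / N\<close>. This is
  largest at \<open>x = k\<close>, where it equals \<open>k\<^sup>-\<^sup>\<alpha> exp (- \<xi> k\<^sup>p)\<close>.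
\<close>

lemma shrinkage_le:
  fixes p \<gamma> \<alpha> \<xi> \<beta> c k N x \<kappa>x :: real
  assumes "p \<ge> 1" "\<gamma> > 0" "\<alpha> \<ge> 0" "\<xi> > 0" "\<beta> > 0" "c > 0" "1 \<le> x" "x \<le> k"
    and N: "N = k powr \<alpha> * exp ((\<xi> + 2 * \<gamma>) * k powr p)"
    and \<kappa>: "\<kappa>x \<ge> c * exp (- \<gamma> * x powr p)"
  defines "\<eta> \<equiv> \<xi> + 2 * \<gamma>" and "l \<equiv> x powr (-\<alpha>) * exp (-\<xi> * x powr p)"
  shows "(1 / N) / (\<kappa>x\<^sup>2 * l + 1 / N) \<le> exp \<eta> / c\<^sup>2 * (\<beta> / \<eta>) powr \<beta> * (x / k) powr \<beta>" (is "?a \<le> _")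
    and "2 * l * ((1 / N) / (\<kappa>x\<^sup>2 * l + 1 / N)) \<le> 2 / c\<^sup>2 * exp (- \<xi> * k)"
proof -
  have \<eta>: "\<eta> > 0" using assms by (simp add: \<eta>_def)
  have Np: "N > 0" using assms by (simp add: N)
  have lp: "l > 0" using assms by (simp add: l_def)
  have \<kappa>2: "\<kappa>x\<^sup>2 \<ge> c\<^sup>2 * exp (- 2 * \<gamma> * x powr p)"
  proof -
    have "(c * exp (- \<gamma> * x powr p))\<^sup>2 \<le> \<kappa>x\<^sup>2" using \<kappa> assms by (intro power_mono) auto
    then show ?thesis by (simp add: power_mult_distrib exp_double[symmetric] mult.assoc)
  qed
  then have \<kappa>p: "\<kappa>x\<^sup>2 > 0" using assms by (smt (verit) exp_gt_zero mult_pos_pos zero_less_power)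
  have \<kappa>l: "\<kappa>x\<^sup>2 * l > 0" "\<kappa>x\<^sup>2 * l + 1 / N > 0"
    using \<kappa>p lp Np by (simp_all add: add_pos_pos)
  have kx: "1 \<le> k / x" using assms by simp
  have "c\<^sup>2 * exp (\<eta> * (k / x - 1)) \<le> c\<^sup>2 * exp (\<eta> * (k powr p - x powr p))"
    using powr_diff_ge[of p x k] assms \<eta> by (intro mult_left_mono) auto
  also have "\<dots> \<le> c\<^sup>2 * exp (\<eta> * (k powr p - x powr p)) * (k / x) powr \<alpha>"
    using mult_left_mono[OF ge_one_powr_ge_zero[OF kx \<open>\<alpha> \<ge> 0\<close>],
        of "c\<^sup>2 * exp (\<eta> * (k powr p - x powr p))"] by simp
  also have "\<dots> = N * (c\<^sup>2 * exp (- 2 * \<gamma> * x powr p)) * l"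
    using assms unfolding N l_def \<eta>_def
    by (simp add: powr_divide powr_minus exp_diff exp_minus exp_add field_simps)
  also have "\<dots> \<le> N * \<kappa>x\<^sup>2 * l"
    using \<kappa>2 Np lp by (intro mult_right_mono mult_left_mono) auto
  finally have key: "c\<^sup>2 * exp (\<eta> * (k / x - 1)) \<le> N * \<kappa>x\<^sup>2 * l" .
  have "?a \<le> 1 / (N * \<kappa>x\<^sup>2 * l)"
  proof -
    have "?a \<le> (1 / N) / (\<kappa>x\<^sup>2 * l)"
      using Np by (intro divide_left_mono mult_pos_pos \<kappa>l) auto
    then show ?thesis by (simp add: mult.assoc)
  qed
  also have "\<dots> \<le> 1 / (c\<^sup>2 * exp (\<eta> * (k / x - 1)))"
    using key assms Np lp \<kappa>p by (intro divide_left_mono) auto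
  also have "\<dots> = exp \<eta> / c\<^sup>2 * (1 / exp (\<eta> * (k / x)))"
    by (simp add: algebra_simps exp_diff)
  also have "\<dots> \<le> exp \<eta> / c\<^sup>2 * ((\<beta> / \<eta>) powr \<beta> * (x / k) powr \<beta>)"
  proof (intro mult_left_mono)
    have "(k / x) powr \<beta> \<le> (\<beta> / \<eta>) powr \<beta> * exp (\<eta> * (k / x))"
      using kx assms \<eta> by (intro powr_le_exp) auto
    moreover have "(k / x) powr \<beta> > 0"
      using kx by (intro powr_gt_zero[THEN iffD2]) linarith
    ultimately have "1 / exp (\<eta> * (k / x)) \<le> (\<beta> / \<eta>) powr \<beta> * (1 / (k / x) powr \<beta>)"
      by (simp add: field_simps)
    also have "1 / (k / x) powr \<beta> = (x / k) powr \<beta>"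
      using assms by (simp add: powr_divide)
    finally show "1 / exp (\<eta> * (k / x)) \<le> (\<beta> / \<eta>) powr \<beta> * (x / k) powr \<beta>" .
  qed auto
  finally show "?a \<le> exp \<eta> / c\<^sup>2 * (\<beta> / \<eta>) powr \<beta> * (x / k) powr \<beta>" by (simp add: mult.assoc)

  have "2 * l * ?a \<le> 2 * l * ((1 / N) / (\<kappa>x\<^sup>2 * l))"
    using Np lp by (intro mult_left_mono divide_left_mono mult_pos_pos \<kappa>l) auto
  also have "\<dots> = 2 / N / \<kappa>x\<^sup>2" using lp Np \<kappa>p by (simp add: field_simps)
  also have "\<dots> \<le> 2 / N / (c\<^sup>2 * exp (- 2 * \<gamma> * x powr p))"
    using \<kappa>2 \<kappa>p Np assms by (intro divide_left_mono) auto
  also have "\<dots> = 2 / c\<^sup>2 * (exp (2 * \<gamma> * x powr p) / N)"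
    by (simp add: exp_minus field_simps)
  also have "\<dots> \<le> 2 / c\<^sup>2 * exp (- \<xi> * k)"
  proof (intro mult_left_mono)
    have "x powr p \<le> k powr p" using assms by (intro powr_mono2) auto
    then have "exp (2 * \<gamma> * x powr p) / N \<le> exp (2 * \<gamma> * k powr p) / N"
      using assms Np by (intro divide_right_mono) auto
    also have "\<dots> = k powr (- \<alpha>) * exp (- \<xi> * k powr p)"
      using assms unfolding N by (simp add: powr_minus exp_add exp_minus field_simps)
    also have "\<dots> \<le> 1 * exp (- \<xi> * k)"
    proof (intro mult_mono)
      show "k powr (- \<alpha>) \<le> 1" using assms powr_mono[of "-\<alpha>" 0 k] by simp
      show "exp (- \<xi> * k powr p) \<le> exp (- \<xi> * k)"
        using assms powr_mono[of 1 p k] by simp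
    qed auto
    finally show "exp (2 * \<gamma> * x powr p) / N \<le> exp (- \<xi> * k)" by simp
  qed auto
  finally show "2 * l * ((1 / N) / (\<kappa>x\<^sup>2 * l + 1 / N)) \<le> 2 / c\<^sup>2 * exp (- \<xi> * k)" .
qed

lemma sobolev_sum_le:
  assumes f: "f \<in> sobolev \<beta>" "sobolev_norm \<beta> f \<le> R"
  shows "(\<Sum>i. (f (Suc i))\<^sup>2 * real (Suc i) powr (2 * \<beta>)) \<le> R\<^sup>2"
    and "(\<Sum>i=1..m. (f i)\<^sup>2 * real i powr (2 * \<beta>)) \<le> R\<^sup>2"
    and "0 < k \<Longrightarrow> k \<le> real (Suc m) \<Longrightarrow> \<beta> \<ge> 0 \<Longrightarrow> (\<Sum>i. (f (Suc (i + m)))\<^sup>2) \<le> R\<^sup>2 * k powr (- 2 * \<beta>)"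
proof -
  let ?g = "\<lambda>i. (f (Suc i))\<^sup>2 * real (Suc i) powr (2 * \<beta>)"
  have s: "summable ?g" using f by (simp add: sobolev_def)
  have "sqrt (\<Sum>i. ?g i) \<le> R" using f(2) by (simp add: sobolev_norm_def)
  moreover have nn: "(\<Sum>i. ?g i) \<ge> 0" by (intro suminf_nonneg s) auto
  ultimately show 1: "(\<Sum>i. ?g i) \<le> R\<^sup>2" using sqrt_le_D by blast
  have "(\<Sum>i=1..m. (f i)\<^sup>2 * real i powr (2 * \<beta>)) = (\<Sum>i<m. ?g i)"
    by (simp only: One_nat_def sum.atLeast_Suc_atMost_Suc_shift[symmetric] atLeast0AtMost[symmetric]
        sum.atLeast1_atMost_eq)
  also have "\<dots> \<le> (\<Sum>i. ?g i)" by (intro sum_le_suminf s) auto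
  finally show "(\<Sum>i=1..m. (f i)\<^sup>2 * real i powr (2 * \<beta>)) \<le> R\<^sup>2" using 1 by linarith
  assume k: "0 < k" "k \<le> real (Suc m)" and \<beta>: "\<beta> \<ge> 0"
  have sf: "summable (\<lambda>i. (f (Suc (i + m)))\<^sup>2)"
    using summable_ignore_initial_segment[of "\<lambda>i. (f (Suc i))\<^sup>2" m] f by (simp add: sobolev_def ell2_def)
  have sg: "summable (\<lambda>i. ?g (i + m))" by (rule summable_ignore_initial_segment[OF s])
  have "(\<Sum>i. (f (Suc (i + m)))\<^sup>2) \<le> (\<Sum>i. ?g (i + m) * k powr (- 2 * \<beta>))"
  proof (intro suminf_le sf summable_mult2 sg)
    fix i
    have "1 \<le> (real (Suc (i + m)) / k) powr (2 * \<beta>)"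
      using k \<beta> by (intro ge_one_powr_ge_zero) auto
    also have "\<dots> = real (Suc (i + m)) powr (2 * \<beta>) * k powr (- 2 * \<beta>)"
      using k by (subst powr_divide) (auto simp: powr_minus divide_inverse)
    finally show "(f (Suc (i + m)))\<^sup>2 \<le> ?g (i + m) * k powr (- 2 * \<beta>)"
      using mult_left_mono[of 1 _ "(f (Suc (i + m)))\<^sup>2"] by (simp add: mult.assoc)
  qed
  also have "\<dots> = (\<Sum>i. ?g (i + m)) * k powr (- 2 * \<beta>)"
    by (rule suminf_mult2[OF sg, symmetric])
  also have "\<dots> \<le> R\<^sup>2 * k powr (- 2 * \<beta>)"
  proof (intro mult_right_mono)
    have "(\<Sum>i. ?g i) = (\<Sum>i. ?g (i + m)) + (\<Sum>i<m. ?g i)"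
      by (rule suminf_split_initial_segment[OF s])
    moreover have "(\<Sum>i<m. ?g i) \<ge> 0" by (intro sum_nonneg) auto
    ultimately show "(\<Sum>i. ?g (i + m)) \<le> R\<^sup>2" using 1 by linarith
  qed auto
  finally show "(\<Sum>i. (f (Suc (i + m)))\<^sup>2) \<le> R\<^sup>2 * k powr (- 2 * \<beta>)" .
qed

text \<open>
  The power \<open>(i / k)\<^sup>\<beta>\<close> in the bound on the shrinkage is exactly what the smoothness of \<open>f\<close> compensates.
  The at most \<open>k\<close> variance terms sum to a multiple of \<open>k exp (- \<xi> k)\<close>, which is smaller than a
  multiple of any negative power of \<open>k\<close>.
\<close>

lemma total_risk_le:
  fixes p \<gamma> \<alpha> \<xi> \<beta> c k N R :: real and \<kappa> f :: "nat \<Rightarrow> real"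
  assumes "p \<ge> 1" "\<gamma> > 0" "\<alpha> \<ge> 0" "\<xi> > 0" "\<beta> > 0" "c > 0" "k \<ge> 1" and m: "real m \<le> k"
    and N: "N = k powr \<alpha> * exp ((\<xi> + 2 * \<gamma>) * k powr p)"
    and \<kappa>: "\<And>i. i \<ge> 1 \<Longrightarrow> \<kappa> i \<ge> c * exp (- \<gamma> * real i powr p)"
    and f: "f \<in> sobolev \<beta>" "sobolev_norm \<beta> f \<le> R"
  defines "l \<equiv> \<lambda>i::nat. real i powr (-\<alpha>) * exp (-\<xi> * real i powr p)"
  defines "a \<equiv> \<lambda>i. (1 / N) / ((\<kappa> i)\<^sup>2 * l i + 1 / N)"
  shows "(\<Sum>i=1..m. (a i)\<^sup>2 * (f i)\<^sup>2 + 2 * l i * a i) \<le>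
    ((exp (\<xi> + 2 * \<gamma>) / c\<^sup>2 * (\<beta> / (\<xi> + 2 * \<gamma>)) powr \<beta>)\<^sup>2 * R\<^sup>2
      + 2 / c\<^sup>2 * ((2 * \<beta> + 1) / \<xi>) powr (2 * \<beta> + 1)) * k powr (- 2 * \<beta>)"
    (is "_ \<le> (?B\<^sup>2 * R\<^sup>2 + 2 / c\<^sup>2 * ?C) * _")
proof -
  let ?K = "k powr (- 2 * \<beta>)"
  have Np: "N > 0" using assms by (simp add: N)
  have "(\<Sum>i=1..m. (a i)\<^sup>2 * (f i)\<^sup>2 + 2 * l i * a i)
      \<le> (\<Sum>i=1..m. ?B\<^sup>2 * ?K * ((f i)\<^sup>2 * real i powr (2 * \<beta>)) + 2 / c\<^sup>2 * exp (- \<xi> * k))"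
  proof (intro sum_mono add_mono)
    fix i assume i: "i \<in> {1..m}"
    then have ik: "1 \<le> real i" "real i \<le> k" using m by auto
    note b = shrinkage_le[OF assms(1-6) ik N \<kappa>[of i]]
    show "2 * l i * a i \<le> 2 / c\<^sup>2 * exp (- \<xi> * k)"
      unfolding a_def l_def using i by (intro b(2)) auto
    have "a i \<le> ?B * (real i / k) powr \<beta>" unfolding a_def l_def using i by (intro b(1)) auto
    moreover have "a i \<ge> 0" using Np by (simp add: a_def l_def)
    ultimately have "(a i)\<^sup>2 \<le> (?B * (real i / k) powr \<beta>)\<^sup>2" by (intro power_mono)
    also have "\<dots> = ?B\<^sup>2 * ?K * real i powr (2 * \<beta>)"
    proof -
      have "((real i / k) powr \<beta>)\<^sup>2 = (real i / k) powr (2 * \<beta>)"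
        using ik by (simp add: powr_power mult.commute)
      also have "\<dots> = ?K * real i powr (2 * \<beta>)"
        using ik by (subst powr_divide) (auto simp: powr_minus divide_inverse)
      finally show ?thesis by (simp only: power_mult_distrib mult.assoc)
    qed
    finally have "(a i)\<^sup>2 * (f i)\<^sup>2 \<le> ?B\<^sup>2 * ?K * real i powr (2 * \<beta>) * (f i)\<^sup>2"
      by (rule mult_right_mono) simp
    then show "(a i)\<^sup>2 * (f i)\<^sup>2 \<le> ?B\<^sup>2 * ?K * ((f i)\<^sup>2 * real i powr (2 * \<beta>))"
      by (simp only: mult.assoc mult.commute[of "real i powr (2 * \<beta>)"])
  qed
  also have "\<dots> = ?B\<^sup>2 * ?K * (\<Sum>i=1..m. (f i)\<^sup>2 * real i powr (2 * \<beta>)) + 2 / c\<^sup>2 * (real m * exp (- \<xi> * k))"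
    by (simp only: sum.distrib sum_distrib_left[symmetric] sum_constant card_atLeastAtMost diff_Suc_1 add_diff_cancel_right')
  also have "\<dots> \<le> ?B\<^sup>2 * ?K * R\<^sup>2 + 2 / c\<^sup>2 * (?C * ?K)"
  proof (intro add_mono mult_left_mono sobolev_sum_le(2)[OF f])
    have "real m * exp (- \<xi> * k) \<le> k * exp (- \<xi> * k)" using m by (intro mult_right_mono) auto
    also have "\<dots> = k powr (2 * \<beta> + 1) * exp (- \<xi> * k) * ?K"
      using assms by (simp add: powr_add powr_minus)
    also have "\<dots> \<le> ?C * ?K"
    proof (intro mult_right_mono)
      have "k powr (2 * \<beta> + 1) \<le> ?C * exp (\<xi> * k)" using assms by (intro powr_le_exp) auto
      then show "k powr (2 * \<beta> + 1) * exp (- \<xi> * k) \<le> ?C" by (simp add: exp_minus field_simps)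
    qed auto
    finally show "real m * exp (- \<xi> * k) \<le> ?C * ?K" .
  qed auto
  also have "\<dots> = (?B\<^sup>2 * R\<^sup>2 + 2 / c\<^sup>2 * ?C) * ?K" by (simp add: algebra_simps)
  finally show ?thesis .
qed

section \<open>Posterior contraction\<close>

lemma truncated_prior_eq:
  assumes "\<And>i. i \<ge> 1 \<Longrightarrow> lam i > 0" "\<And>i. real i \<le> k \<longleftrightarrow> i \<le> m"
  shows "truncated_prior lam k
    = restrict_space (\<Pi>\<^sub>M i\<in>{1..}. gauss 0 (if 1 \<le> i \<and> i \<le> m then lam i else 0)) ell2"
  unfolding truncated_prior_def using assms
  by (intro arg_cong2[where f=restrict_space] PiM_cong) (auto simp: gauss_eq_density gauss_0)

text \<open>
  Beyond \<open>m\<close> the loss is that of estimating \<open>f0\<close> by zero. Subtracting it leaves a condition on finitely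
  many coordinates.
\<close>

lemma ell2_norm_diff_head:
  assumes f: "f \<in> ell2" and f0: "f0 \<in> ell2" and 0: "\<And>i. i > m \<Longrightarrow> f i = 0"
    and \<rho>: "0 \<le> \<rho>" "\<rho> \<le> ell2_norm (\<lambda>i. f i - f0 i)"
  shows "\<rho>\<^sup>2 - (\<Sum>i. (f0 (Suc (i + m)))\<^sup>2) \<le> (\<Sum>i=1..m. (f i - f0 i)\<^sup>2)"
proof -
  let ?g = "\<lambda>i. (f (Suc i) - f0 (Suc i))\<^sup>2"
  have tail: "?g (i + m) = (f0 (Suc (i + m)))\<^sup>2" for i using 0 by simp
  have "summable (\<lambda>i. (f0 (Suc (i + m)))\<^sup>2)"
    using summable_ignore_initial_segment[of "\<lambda>i. (f0 (Suc i))\<^sup>2" m] f0 by (simp add: ell2_def)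
  then have s: "summable ?g"
    using tail summable_iff_shift[of ?g m] by simp
  have "\<rho>\<^sup>2 \<le> (ell2_norm (\<lambda>i. f i - f0 i))\<^sup>2" using \<rho> by (intro power_mono)
  also have "\<dots> = (\<Sum>i. ?g i)"
    unfolding ell2_norm_def by (intro real_sqrt_pow2 suminf_nonneg s) auto
  also have "\<dots> = (\<Sum>i. ?g (i + m)) + (\<Sum>i<m. ?g i)"
    by (rule suminf_split_initial_segment[OF s])
  also have "(\<Sum>i<m. ?g i) = (\<Sum>i=1..m. (f i - f0 i)\<^sup>2)"
    by (simp only: One_nat_def sum.atLeast1_atMost_eq)
  finally show ?thesis using tail by simp
qed

text \<open>
  The loss threshold \<open>M * r\<close> exceeds the truncation bias as soon as \<open>M\<close> is large: at least half of
  its square, bounded below by \<open>e = b\<^sup>2 M\<^sup>2 k\<^sup>-\<^sup>2\<^sup>\<beta> / 2\<close>, must come from the first \<open>m\<close> coordinates.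
  Their total risk is at most \<open>D k\<^sup>-\<^sup>2\<^sup>\<beta>\<close>, so that the powers of \<open>k\<close> cancel. The level
  \<open>t = 1 / M\<close> in \<open>posterior_mass\<close> makes both terms of its bound tend to zero.
\<close>

lemma posterior_contraction_bound:
  fixes p \<gamma> \<alpha> \<xi> \<beta> c C R k M b :: real and \<kappa> :: "nat \<Rightarrow> real"
  assumes pars: "p \<ge> 1" "\<gamma> > 0" "\<alpha> \<ge> 0" "\<xi> > 0" "\<beta> > 0" "c > 0" and k: "k \<ge> 1"
    and n: "n > 0" "real n = k powr \<alpha> * exp ((\<xi> + 2 * \<gamma>) * k powr p)"
    and \<kappa>: "\<And>i. i \<ge> 1 \<Longrightarrow> \<kappa> i \<ge> c * exp (- \<gamma> * real i powr p)" "\<And>i. i \<ge> 1 \<Longrightarrow> \<bar>\<kappa> i\<bar> \<le> C"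
    and f0: "f0 \<in> sobolev \<beta>" "sobolev_norm \<beta> f0 \<le> R"
  defines "lam \<equiv> \<lambda>i::nat. real i powr (-\<alpha>) * exp (-\<xi> * real i powr p)"
  defines "D \<equiv> (exp (\<xi> + 2 * \<gamma>) / c\<^sup>2 * (\<beta> / (\<xi> + 2 * \<gamma>)) powr \<beta>)\<^sup>2 * R\<^sup>2
      + 2 / c\<^sup>2 * ((2 * \<beta> + 1) / \<xi>) powr (2 * \<beta> + 1)"
  assumes post: "is_posterior (truncated_prior lam k) seq_space (obs_law \<kappa> n) K"
    and b: "b > 0" "b * k powr (- \<beta>) \<le> r" and M: "M > 0" "b\<^sup>2 * M\<^sup>2 \<ge> 2 * R\<^sup>2"
  shows "(\<integral>\<^sup>+ y. emeasure (K y) {f \<in> ell2. ell2_norm (\<lambda>i. f i - f0 i) \<ge> M * r} \<partial>obs_law \<kappa> n f0)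
    \<le> ennreal (1 / M + sqrt (6 * D / b\<^sup>2 / M))"
proof -
  define m where "m = nat \<lfloor>k\<rfloor>"
  have m: "real i \<le> k \<longleftrightarrow> i \<le> m" for i using k by (auto simp: m_def le_nat_iff le_floor_iff)
  then have mk: "real m \<le> k" "k \<le> real (Suc m)" using m[of "Suc m"] by auto
  define l where "l i = (if 1 \<le> i \<and> i \<le> m then lam i else 0)" for i
  interpret G: gaussian_sequence_model \<kappa> l n m
    using n by unfold_locales (auto simp: l_def lam_def)
  have prior: "truncated_prior lam k = restrict_space G.prior ell2"
    unfolding G.prior_def l_def using m by (intro truncated_prior_eq) (auto simp: lam_def)
  have f0': "f0 \<in> ell2" using f0 by (simp add: sobolev_def)
  let ?A = "{f \<in> ell2. ell2_norm (\<lambda>i. f i - f0 i) \<ge> M * r}"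
  have A: "?A \<in> sets (restrict_space G.prior ell2)"
    using sets_ell2_norm_ge[OF f0', of "M * r"]
    by (subst sets_restrict_space_iff[OF G.ell2_in_sets_prior]) auto
  let ?K = "k powr (- 2 * \<beta>)"
  have Kp: "?K > 0" using k by simp
  have K2: "(k powr (- \<beta>))\<^sup>2 = ?K" using k by (simp add: powr_power)
  define e where "e = b\<^sup>2 * M\<^sup>2 / 2 * ?K"
  have e: "e > 0" using b M Kp by (simp add: e_def)
  have r: "r \<ge> 0" using b k by (smt (verit) mult_nonneg_nonneg powr_ge_zero)
  have "(b * k powr (- \<beta>))\<^sup>2 \<le> r\<^sup>2" using b by (intro power_mono) auto
  then have r2: "b\<^sup>2 * ?K \<le> r\<^sup>2" by (simp add: power_mult_distrib K2)
  have "M\<^sup>2 * (b\<^sup>2 * ?K) \<le> M\<^sup>2 * r\<^sup>2" using r2 by (intro mult_left_mono) auto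
  moreover have "2 * R\<^sup>2 * ?K \<le> b\<^sup>2 * M\<^sup>2 * ?K" using M Kp by (intro mult_right_mono) auto
  ultimately have e_le: "e \<le> (M * r)\<^sup>2 - R\<^sup>2 * ?K" by (simp add: e_def power_mult_distrib algebra_simps)
  have tail: "(\<Sum>i. (f0 (Suc (i + m)))\<^sup>2) \<le> R\<^sup>2 * ?K"
    using k mk pars by (intro sobolev_sum_le(3)[OF f0]) auto
  have loss: "AE f in G.prior. f \<in> ?A \<longrightarrow> e \<le> (\<Sum>i=1..m. (f i - f0 i)\<^sup>2)"
    using G.AE_prior_vanishes
  proof eventually_elim
    case (elim f)
    show ?case
    proof
      assume "f \<in> ?A"
      then have "(M * r)\<^sup>2 - (\<Sum>i. (f0 (Suc (i + m)))\<^sup>2) \<le> (\<Sum>i=1..m. (f i - f0 i)\<^sup>2)"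
        using elim f0' M r by (intro ell2_norm_diff_head) auto
      then show "e \<le> (\<Sum>i=1..m. (f i - f0 i)\<^sup>2)" using tail e_le by linarith
    qed
  qed
  have "(\<Sum>i=1..m. (G.shrink i)\<^sup>2 * (f0 i)\<^sup>2 + 2 * l i * G.shrink i) \<le> D * ?K"
  proof -
    have "(\<Sum>i=1..m. (G.shrink i)\<^sup>2 * (f0 i)\<^sup>2 + 2 * l i * G.shrink i)
      = (\<Sum>i=1..m. ((1 / n) / ((\<kappa> i)\<^sup>2 * lam i + 1 / n))\<^sup>2 * (f0 i)\<^sup>2
          + 2 * lam i * ((1 / n) / ((\<kappa> i)\<^sup>2 * lam i + 1 / n)))"
      by (intro sum.cong) (auto simp: G.shrink_def G.marg_var_def G.noise_var_def l_def)
    also have "\<dots> \<le> D * ?K"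
      unfolding D_def lam_def by (rule total_risk_le[OF pars k mk(1) n(2) \<kappa>(1) f0])
    finally show ?thesis .
  qed
  then have "(\<Sum>i=1..m. (G.shrink i)\<^sup>2 * (f0 i)\<^sup>2 + 2 * l i * G.shrink i) / e \<le> D * ?K / e"
    using e by (intro divide_right_mono) auto
  also have "\<dots> = 2 * D / b\<^sup>2 / M\<^sup>2" using Kp b M by (simp add: e_def)
  finally have risk: "(\<Sum>i=1..m. (G.shrink i)\<^sup>2 * (f0 i)\<^sup>2 + 2 * l i * G.shrink i) / e \<le> 2 * D / b\<^sup>2 / M\<^sup>2" .
  have "summable (\<lambda>i. C\<^sup>2 * (f0 (Suc i))\<^sup>2)"
    using f0' by (intro summable_mult) (simp add: ell2_def)
  then have "summable (\<lambda>i. (\<kappa> (Suc i) * f0 (Suc i))\<^sup>2)"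
  proof (rule summable_comparison_test'[where N=0])
    fix i
    have "\<bar>\<kappa> (Suc i)\<bar>\<^sup>2 \<le> C\<^sup>2" using \<kappa>(2)[of "Suc i"] by (intro power_mono) auto
    then show "norm ((\<kappa> (Suc i) * f0 (Suc i))\<^sup>2) \<le> C\<^sup>2 * (f0 (Suc i))\<^sup>2"
      by (simp add: power_mult_distrib mult_right_mono)
  qed
  from G.posterior_mass[OF post[unfolded prior] A e _ loss this risk, of "1 / M"] M(1)
  have "(\<integral>\<^sup>+ y. emeasure (K y) ?A \<partial>obs_law \<kappa> n f0)
      \<le> ennreal (1 / M + sqrt (3 * (2 * D / b\<^sup>2 / M\<^sup>2 / (1 / M))))" by simp
  also have "3 * (2 * D / b\<^sup>2 / M\<^sup>2 / (1 / M)) = 6 * D / b\<^sup>2 / M"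
    using M(1) by (simp add: power2_eq_square)
  finally show ?thesis .
qed

theorem theorem3p2:
  fixes p \<gamma> \<alpha> \<xi> \<beta> R :: real
    and \<kappa> :: "nat \<Rightarrow> real"
    and k :: "nat \<Rightarrow> real"
    and post :: "nat \<Rightarrow> (nat \<Rightarrow> real) \<Rightarrow> (nat \<Rightarrow> real) measure"
    and M :: "nat \<Rightarrow> real"
  defines "lam \<equiv> \<lambda>i::nat. real i powr (-\<alpha>) * exp (-\<xi> * real i powr p)"
  assumes "p \<ge> 1" and "\<gamma> > 0" and "\<alpha> \<ge> 0" and "\<xi> > 0" and "\<beta> > 0" and "R > 0"
    and "\<And>i. i \<ge> 1 \<Longrightarrow> \<kappa> i > 0"
    and "comparable \<kappa> (\<lambda>i. exp (-\<gamma> * real i powr p))"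
    and "\<And>n. n \<ge> 2 \<Longrightarrow> k n > 0 \<and>
           1 = real n * k n powr (-\<alpha>) * exp (-(\<xi> + 2 * \<gamma>) * k n powr p)"
    and "\<And>n. n \<ge> 2 \<Longrightarrow>
           is_posterior (truncated_prior lam (k n)) seq_space (obs_law \<kappa> n) (post n)"
    and "filterlim M at_top sequentially"
  shows "(\<lambda>n. SUP f0\<in>{f0 \<in> sobolev \<beta>. sobolev_norm \<beta> f0 \<le> R}.
            \<integral>\<^sup>+ y. emeasure (post n y)
                   {f \<in> ell2. ell2_norm (\<lambda>i. f i - f0 i) \<ge> M n * ln (real n) powr (-\<beta> / p)}
               \<partial>obs_law \<kappa> n f0)
         \<longlonglongrightarrow> 0"
proof -
  note pars = assms(2-6)
  let ?\<eta> = "\<xi> + 2 * \<gamma>"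
  have \<eta>: "?\<eta> > 0" using pars by simp
  obtain c C where c: "c > 0"
    and cC: "\<And>i. i \<ge> 1 \<Longrightarrow> c \<le> \<bar>\<kappa> i / exp (-\<gamma> * real i powr p)\<bar> \<and> \<bar>\<kappa> i / exp (-\<gamma> * real i powr p)\<bar> \<le> C"
    using assms(9) unfolding comparable_def by blast
  have \<kappa>_lower: "\<kappa> i \<ge> c * exp (- \<gamma> * real i powr p)" if "i \<ge> 1" for i
    using cC[OF that] assms(8)[OF that] by (simp add: field_simps)
  have \<kappa>_upper: "\<bar>\<kappa> i\<bar> \<le> C" if "i \<ge> 1" for i
  proof -
    have "C > 0" using cC[OF that] c by linarith
    have "\<bar>\<kappa> i\<bar> \<le> C * exp (- \<gamma> * real i powr p)"
      using cC[OF that] by (simp add: field_simps)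
    also have "\<dots> \<le> C * 1" using \<open>C > 0\<close> pars by (intro mult_left_mono) auto
    finally show ?thesis by simp
  qed
  have n_eq: "real n = k n powr \<alpha> * exp (?\<eta> * k n powr p)" if "n \<ge> 2" for n
  proof -
    have "k n powr (-\<alpha>) * exp (- ?\<eta> * k n powr p) * real n = 1"
      using assms(10)[OF that] by (simp add: mult.commute mult.left_commute)
    moreover have "k n powr (-\<alpha>) * exp (- ?\<eta> * k n powr p) = inverse (k n powr \<alpha> * exp (?\<eta> * k n powr p))"
      by (simp only: powr_minus exp_minus inverse_mult_distrib mult_minus_left)
    moreover have "k n powr \<alpha> * exp (?\<eta> * k n powr p) \<noteq> 0" using assms(10)[OF that] by simp
    ultimately show ?thesis by (simp add: field_simps)
  qed
  define b where "b = (\<alpha> + ?\<eta>) powr (- \<beta> / p)"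
  have b: "b > 0" using pars by (simp add: b_def)
  define D where "D = (exp ?\<eta> / c\<^sup>2 * (\<beta> / ?\<eta>) powr \<beta>)\<^sup>2 * R\<^sup>2
      + 2 / c\<^sup>2 * ((2 * \<beta> + 1) / \<xi>) powr (2 * \<beta> + 1)"
  have bound: "(SUP f0\<in>{f0 \<in> sobolev \<beta>. sobolev_norm \<beta> f0 \<le> R}.
        \<integral>\<^sup>+ y. emeasure (post n y)
          {f \<in> ell2. ell2_norm (\<lambda>i. f i - f0 i) \<ge> M n * ln (real n) powr (-\<beta> / p)} \<partial>obs_law \<kappa> n f0)
      \<le> ennreal (1 / M n + sqrt (6 * D / b\<^sup>2 / M n))"
    if n: "n \<ge> 2" "real n > exp ?\<eta>" and M: "M n \<ge> 1" "M n \<ge> 2 * R\<^sup>2 / b\<^sup>2" for n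
  proof (rule SUP_least)
    fix f0 assume "f0 \<in> {f0 \<in> sobolev \<beta>. sobolev_norm \<beta> f0 \<le> R}"
    then have f0: "f0 \<in> sobolev \<beta>" "sobolev_norm \<beta> f0 \<le> R" by auto
    have k: "k n \<ge> 1"
      using assms(10)[OF n(1)] pars \<eta> n_eq[OF n(1)] n(2)
      by (intro truncation_point_ge_1[of p \<alpha> ?\<eta> "k n" "real n"]) auto
    have r: "b * k n powr (- \<beta>) \<le> ln (real n) powr (- \<beta> / p)"
      unfolding b_def using pars \<eta> k n_eq[OF n(1)] by (intro truncation_point_rate) auto
    have "2 * R\<^sup>2 \<le> b\<^sup>2 * M n" using M(2) b by (simp add: field_simps)
    also have "\<dots> \<le> b\<^sup>2 * (M n)\<^sup>2" using M(1) by (intro mult_left_mono) (auto simp: power2_eq_square)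
    finally have M2: "b\<^sup>2 * (M n)\<^sup>2 \<ge> 2 * R\<^sup>2" .
    show "(\<integral>\<^sup>+ y. emeasure (post n y)
          {f \<in> ell2. ell2_norm (\<lambda>i. f i - f0 i) \<ge> M n * ln (real n) powr (-\<beta> / p)} \<partial>obs_law \<kappa> n f0)
        \<le> ennreal (1 / M n + sqrt (6 * D / b\<^sup>2 / M n))"
      unfolding D_def using n M(1)
      by (intro posterior_contraction_bound[OF pars c k _ n_eq[OF n(1)] \<kappa>_lower \<kappa>_upper f0
            assms(11)[OF n(1), unfolded lam_def] b r _ M2]) auto
  qed
  have ev: "\<forall>\<^sub>F n in sequentially. n \<ge> 2 \<and> real n > exp ?\<eta> \<and> M n \<ge> 1 \<and> M n \<ge> 2 * R\<^sup>2 / b\<^sup>2"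
  proof (intro eventually_conj)
    show "\<forall>\<^sub>F n in sequentially. real n > exp ?\<eta>"
      using filterlim_real_sequentially unfolding filterlim_at_top_dense by (rule spec)
    have "\<forall>\<^sub>F n in sequentially. Z \<le> M n" for Z
      using assms(12) unfolding filterlim_at_top by (rule spec)
    then show "\<forall>\<^sub>F n in sequentially. M n \<ge> 1"
      "\<forall>\<^sub>F n in sequentially. M n \<ge> 2 * R\<^sup>2 / b\<^sup>2"
      by this+
  qed (rule eventually_ge_at_top)
  have lim: "(\<lambda>n. 1 / M n + sqrt (6 * D / b\<^sup>2 / M n)) \<longlonglongrightarrow> 0 + sqrt 0"
    by (intro tendsto_add tendsto_real_sqrt tendsto_divide_0[OF tendsto_const]
        filterlim_at_top_imp_at_infinity assms(12))
  have "(\<lambda>n. ennreal (1 / M n + sqrt (6 * D / b\<^sup>2 / M n))) \<longlonglongrightarrow> ennreal 0"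
    using lim by (intro tendsto_ennrealI) simp
  then have lim0: "(\<lambda>n. ennreal (1 / M n + sqrt (6 * D / b\<^sup>2 / M n))) \<longlonglongrightarrow> 0" by simp
  show ?thesis
  proof (rule tendsto_sandwich[OF _ _ tendsto_const lim0])
    show "\<forall>\<^sub>F n in sequentially. (SUP f0\<in>{f0 \<in> sobolev \<beta>. sobolev_norm \<beta> f0 \<le> R}.
        \<integral>\<^sup>+ y. emeasure (post n y)
          {f \<in> ell2. ell2_norm (\<lambda>i. f i - f0 i) \<ge> M n * ln (real n) powr (-\<beta> / p)} \<partial>obs_law \<kappa> n f0)
      \<le> ennreal (1 / M n + sqrt (6 * D / b\<^sup>2 / M n))"
      using ev by eventually_elim (intro bound; simp)
  qed simp
qed

end
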